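(* Let $E$ be a Fréchet space and let $B=(b_{i,k})_{i,k\in\mathbb{N}}$, $C=(c_{j,k})_{j,k\in\mathbb{N}}$ be Köthe matrices. The following statements are equivalent. (1) $(E,\lambda^\infty_0(B),\lambda(C))\in\mathfrak{TF}$. (2) $(E,\lambda^\infty_0(B),\lambda^\infty(C))\in\mathfrak{TF}$. (3) There exists a nondecreasing function $S:\mathbb{N}\to\mathbb{N}$ such that for every nondecreasing $\phi:\mathbb{N}\to\mathbb{N}$ the following holds: there exists $k_0\in\mathbb{N}$ such that for every $k\ge k_0$ there exist $q_k\in\mathbb{N}$ and $C_k>0$ with $$\|u'\|^*_{S(k)}\,c_{j,k}\le C_k\max_{1\le q\le q_k}\Bigl\{\frac{c_{j,q}}{b_{i,\phi(q)}}\Bigr\}\max_{1\le q\le q_k}\Bigl\{b_{i,q}\,\|u'\|^*_{\phi(q)}\Bigr\}$$ for every $u'\in E'$ and $i,j\in\mathbb{N}$.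
   Context: $\mathbb{N}=\{1,2,3,\dots\}$. Every Fréchet space is equipped with a fixed grading, i.e. an increasing sequence of seminorms $(\|\cdot\|_k)_{k\in\mathbb{N}}$ defining its topology. $E'$ is the topological dual, and $\|u'\|^*_k=\sup_{\|x\|_k\le1}|u'(x)|\in[0,\infty]$ for $u'\in E'$. A Köthe matrix is a matrix $(a_{n,k})_{n,k\in\mathbb{N}}$ of non-negative scalars with $a_{n,k}\le a_{n,k+1}$ for all $n,k$, such that for every $n$ there is $k$ with $a_{n,k}>0$. With $\mathbb{K}=\mathbb{R}$ or $\mathbb{C}$: $\lambda(A)=\{x\in\mathbb{K}^{\mathbb{N}}:\|x\|_k=\sum_j|x_j|a_{j,k}<\infty\ \forall k\}$; $\lambda^\infty(A)=\{x\in\mathbb{K}^{\mathbb{N}}:\|x\|_k=\sup_j|x_j|a_{j,k}<\infty\ \forall k\}$; $\lambda^\infty_0(A)=\{x\in\lambda^\infty(A):\lim_{j\to\infty}x_ja_{j,k}=0\ \forall k\}$, each graded by the indicated seminorms. $L(E,F)$ is the space of continuous linear operators $E\to F$. For $T\in L(E,F)$ put $\|T\|_{k,r}=\sup_{\|x\|_r\le1}\|Tx\|_k\in[0,\infty]$ and $\pi_T(k)=\inf\{r\in\mathbb{N}:\|T\|_{k,r}<\infty\}$. $L^G(E,F)$ is the set of $T\in L(E,F)$ of the form $T=RQ$ with $Q\in L(E,G)$, $R\in L(G,F)$. $(E,G,F)\in\mathfrak{TF}$ (tame factorization property) means: there is a nondecreasing $S:\mathbb{N}\to\mathbb{N}$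 such that for every $T\in L^G(E,F)$ there is $k_0$ with $\pi_T(k)\le S(k)$ for all $k\ge k_0$. Conventions: quantities are computed in $[0,\infty]$ with $1/0=\infty$ and, inside a single term, $0\cdot\infty=0$ (so $0/0=0$); a product of two maxima is $\infty$ as soon as one of the maxima is $\infty$. *)

theory Defs
  imports "HOL-Analysis.Analysis" "HOL-Library.Function_Algebras"
begin

text \<open>
  The index set \<open>{1, 2, 3, \<dots>}\<close> is represented by the type \<open>nat\<close>, shifted by one: the first
  seminorm, matrix column and coordinate have index \<open>0\<close>. Only the order of the indices is used.
\<close>

text \<open>
  The scalar field is the reals (\<open>w = 0\<close>) or the complex numbers (\<open>w * w = - 1\<close>). The
  multiplicativity of the norm forces it to be the usual absolute value.
\<close>

class real_or_complex = real_normed_field + banach +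
  assumes real_or_complex:
    "\<exists>w. (w = 0 \<or> w * w = - 1) \<and> (\<forall>z. \<exists>s t. z = s *\<^sub>R 1 + t *\<^sub>R w)"

instance real :: real_or_complex
  by intro_classes (rule exI[of _ 0], auto)

instance complex :: real_or_complex
  by intro_classes (rule exI[of _ \<i>], auto simp: complex_eq_iff)


section \<open>Graded spaces\<close>

text \<open>
  The elements of a graded space form a subset \<open>carrier\<close> of an ambient additive group, so that
  proper spaces of sequences are covered. Linear maps between graded spaces are functions on the
  ambient types of which only the values on the carrier are relevant.
\<close>

record ('k, 'e) graded_space =
  carrier :: "'e set"
  scale :: "'k \<Rightarrow> 'e \<Rightarrow> 'e"
  seminorm :: "nat \<Rightarrow> 'e \<Rightarrow> real"

definition graded_topology :: "('k, 'e::ab_group_add) graded_space \<Rightarrow> 'e topology" where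
  "graded_topology E = topology_generated_by
     {{y \<in> carrier E. seminorm E k (y - x) < \<epsilon>} | k x \<epsilon>. x \<in> carrier E \<and> 0 < \<epsilon>}"

definition seminorm_on ::
    "'e set \<Rightarrow> ('k::real_normed_field \<Rightarrow> 'e \<Rightarrow> 'e) \<Rightarrow> ('e::ab_group_add \<Rightarrow> real) \<Rightarrow> bool" where
  "seminorm_on V s p \<longleftrightarrow>
     (\<forall>x\<in>V. 0 \<le> p x) \<and>
     (\<forall>x\<in>V. \<forall>y\<in>V. p (x + y) \<le> p x + p y) \<and>
     (\<forall>a. \<forall>x\<in>V. p (s a x) = norm a * p x)"

definition graded_Cauchy ::
    "('k, 'e::ab_group_add) graded_space \<Rightarrow> (nat \<Rightarrow> 'e) \<Rightarrow> bool" where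
  "graded_Cauchy E X \<longleftrightarrow>
     (\<forall>n. X n \<in> carrier E) \<and>
     (\<forall>k. \<forall>\<epsilon>>0. \<exists>N. \<forall>m\<ge>N. \<forall>n\<ge>N. seminorm E k (X m - X n) < \<epsilon>)"

definition frechet_space ::
    "('k::real_or_complex, 'e::ab_group_add) graded_space \<Rightarrow> bool" where
  "frechet_space E \<longleftrightarrow>
     vector_space (scale E) \<and>
     module.subspace (scale E) (carrier E) \<and>
     (\<forall>k. seminorm_on (carrier E) (scale E) (seminorm E k)) \<and>
     (\<forall>k. \<forall>x\<in>carrier E. seminorm E k x \<le> seminorm E (Suc k) x) \<and>
     Hausdorff_space (graded_topology E) \<and>
     (\<forall>X. graded_Cauchy E X \<longrightarrow> (\<exists>l. limitin (graded_topology E) X l sequentially))"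


section \<open>Continuous linear maps\<close>

definition linear_between ::
    "'e set \<Rightarrow> ('k \<Rightarrow> 'e \<Rightarrow> 'e) \<Rightarrow> ('k \<Rightarrow> 'f \<Rightarrow> 'f) \<Rightarrow>
     ('e::ab_group_add \<Rightarrow> 'f::ab_group_add) \<Rightarrow> bool" where
  "linear_between V s t T \<longleftrightarrow>
     (\<forall>x\<in>V. \<forall>y\<in>V. T (x + y) = T x + T y) \<and> (\<forall>a. \<forall>x\<in>V. T (s a x) = t a (T x))"

definition continuous_operators ::
    "('k, 'e::ab_group_add) graded_space \<Rightarrow> ('k, 'f::ab_group_add) graded_space \<Rightarrow>
     ('e \<Rightarrow> 'f) set" where
  "continuous_operators E F =
     {T. T \<in> carrier E \<rightarrow> carrier F \<and>
         linear_between (carrier E) (scale E) (scale F) T \<and>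
         continuous_map (graded_topology E) (graded_topology F) T}"

definition topological_dual ::
    "('k::real_or_complex, 'e::ab_group_add) graded_space \<Rightarrow> ('e \<Rightarrow> 'k) set" where
  "topological_dual E =
     {u. linear_between (carrier E) (scale E) (*) u \<and>
         continuous_map (graded_topology E) euclidean u}"

definition dual_norm ::
    "('k::real_or_complex, 'e) graded_space \<Rightarrow> nat \<Rightarrow> ('e \<Rightarrow> 'k) \<Rightarrow> ennreal" where
  "dual_norm E k u = (SUP x\<in>{x \<in> carrier E. seminorm E k x \<le> 1}. ennreal (norm (u x)))"

definition operator_norm ::
    "('k, 'e) graded_space \<Rightarrow> ('k, 'f) graded_space \<Rightarrow> nat \<Rightarrow> nat \<Rightarrow> ('e \<Rightarrow> 'f) \<Rightarrow> ennreal" where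
  "operator_norm E F k r T =
     (SUP x\<in>{x \<in> carrier E. seminorm E r x \<le> 1}. ennreal (seminorm F k (T x)))"

text \<open>For a continuous operator \<open>T\<close> the infimum is taken over a nonempty set.\<close>

definition continuity_index ::
    "('k, 'e) graded_space \<Rightarrow> ('k, 'f) graded_space \<Rightarrow> ('e \<Rightarrow> 'f) \<Rightarrow> nat \<Rightarrow> nat" where
  "continuity_index E F T k = Inf {r. operator_norm E F k r T < \<infinity>}"

definition factorized_operators ::
    "('k, 'e::ab_group_add) graded_space \<Rightarrow> ('k, 'g::ab_group_add) graded_space \<Rightarrow>
     ('k, 'f::ab_group_add) graded_space \<Rightarrow> ('e \<Rightarrow> 'f) set" where
  "factorized_operators E G F =
     {T \<in> continuous_operators E F.
        \<exists>Q\<in>continuous_operators E G. \<exists>R\<in>continuous_operators G F.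
          \<forall>x\<in>carrier E. T x = R (Q x)}"

definition tame_factorization ::
    "('k, 'e::ab_group_add) graded_space \<Rightarrow> ('k, 'g::ab_group_add) graded_space \<Rightarrow>
     ('k, 'f::ab_group_add) graded_space \<Rightarrow> bool" where
  "tame_factorization E G F \<longleftrightarrow>
     (\<exists>S::nat \<Rightarrow> nat. mono S \<and>
        (\<forall>T\<in>factorized_operators E G F. \<exists>k0. \<forall>k\<ge>k0. continuity_index E F T k \<le> S k))"


section \<open>Koethe spaces\<close>

definition koethe_matrix :: "(nat \<Rightarrow> nat \<Rightarrow> real) \<Rightarrow> bool" where
  "koethe_matrix a \<longleftrightarrow>
     (\<forall>n k. 0 \<le> a n k) \<and> (\<forall>n k. a n k \<le> a n (Suc k)) \<and> (\<forall>n. \<exists>k. 0 < a n k)"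

definition koethe_l1 ::
    "(nat \<Rightarrow> nat \<Rightarrow> real) \<Rightarrow> ('k::real_or_complex, nat \<Rightarrow> 'k) graded_space" where
  "koethe_l1 a =
     \<lparr>carrier = {x. \<forall>k. summable (\<lambda>j. norm (x j) * a j k)},
      scale = (\<lambda>t x j. t * x j),
      seminorm = (\<lambda>k x. \<Sum>j. norm (x j) * a j k)\<rparr>"

definition koethe_linf ::
    "(nat \<Rightarrow> nat \<Rightarrow> real) \<Rightarrow> ('k::real_or_complex, nat \<Rightarrow> 'k) graded_space" where
  "koethe_linf a =
     \<lparr>carrier = {x. \<forall>k. bdd_above (range (\<lambda>j. norm (x j) * a j k))},
      scale = (\<lambda>t x j. t * x j),
      seminorm = (\<lambda>k x. SUP j. norm (x j) * a j k)\<rparr>"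

definition koethe_c0 ::
    "(nat \<Rightarrow> nat \<Rightarrow> real) \<Rightarrow> ('k::real_or_complex, nat \<Rightarrow> 'k) graded_space" where
  "koethe_c0 a = (koethe_linf a)
     \<lparr>carrier := {x \<in> carrier (koethe_linf a).
                   \<forall>k. (\<lambda>j. x j * of_real (a j k)) \<longlonglongrightarrow> 0}\<rparr>"


section \<open>Product of two maxima\<close>

text \<open>
  Inside a single term \<open>0 * \<infinity> = 0\<close>, \<open>1 / 0 = \<infinity>\<close> and \<open>0 / 0 = 0\<close>, which are the conventions of
  the type \<open>ennreal\<close>. A product of two maxima, however, is \<open>\<infinity>\<close> as soon as one factor is \<open>\<infinity>\<close>,
  even if the other one is \<open>0\<close>.
\<close>

definition max_product :: "ennreal \<Rightarrow> ennreal \<Rightarrow> ennreal" where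
  "max_product x y = (if x = \<infinity> \<or> y = \<infinity> then \<infinity> else x * y)"

end

theory Submission
  imports Defs
begin

text \<open>
  Suppose that every factorized operator is tame, but that the estimate fails for infinitely many
  \<open>k\<close>. From the counterexamples \<open>u l\<close>, \<open>i l\<close>, \<open>j l\<close>, suitably scaled, form the operators
  \<open>Q x = (\<Sum>l. a l * 2^(-l) * u l x * e (i l))\<close> with signs \<open>a l\<close> and
  \<open>R y = (\<Sum>l. 2^(-l) * t l * y (i l) * e (j l))\<close> with \<open>t l > 0\<close>. By the Baire category theorem on the
  Cantor space of signs, some choice of signs makes \<open>R Q\<close> violate tameness at all these \<open>k\<close>.

  Conversely, let \<open>T = R Q\<close> where \<open>R\<close> has the matrix \<open>r i j\<close>. Continuity of \<open>R\<close> bounds the bilinear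
  forms \<open>r i j * c j q / b i (\<phi> q)\<close> on sup-normed spaces, the estimate bounds \<open>norm (Q x i) * c j k\<close>
  by a multiple of the largest \<open>c j q / b i (\<phi> q)\<close>, and the form \<open>r i j * Q x i * c j k\<close> has to be
  bounded. For the target \<open>\<lambda>\<^sup>\<infinity>(C)\<close> only single columns matter and absolute values could be summed.
  For \<open>\<lambda>(C)\<close> the forms need not be absolutely summable, so the index pairs are split instead:
  after rescaling rows and columns by powers of 2, the domination by the \<open>q\<close>-th form reads
  \<open>p q i \<le> s q j\<close> for integer labels. The pairs with \<open>s q j - p q i = d\<close> are cut out by a contraction
  and contribute \<open>O(2^(-d))\<close>, and inclusion-exclusion over \<open>q\<close> collects all pairs. The same argument
  covers both targets.
\<close>

section \<open>Bounded bilinear forms on sup-normed spaces\<close>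

text \<open>For finite \<open>I\<close> and \<open>J\<close> the least such \<open>B\<close> is the
  norm of the matrix \<open>X\<close> as an operator from the sup-normed space over \<open>I\<close>
  to the space over \<open>J\<close> with the sum norm. This is how operators into
  \<open>\<lambda>(C)\<close> enter.\<close>

definition bilinear_bound ::
    "'i set \<Rightarrow> 'j set \<Rightarrow> ('i \<Rightarrow> 'j \<Rightarrow> 'k::real_normed_field) \<Rightarrow> real \<Rightarrow> bool" where
  "bilinear_bound I J X B \<longleftrightarrow>
     (\<forall>x y. (\<forall>i\<in>I. norm (x i) \<le> 1) \<and> (\<forall>j\<in>J. norm (y j) \<le> 1) \<longrightarrow>
        norm (\<Sum>i\<in>I. \<Sum>j\<in>J. x i * y j * X i j) \<le> B)"

lemma bilinear_boundD:
  assumes "bilinear_bound I J X B" "\<And>i. i \<in> I \<Longrightarrow> norm (x i) \<le> 1" "\<And>j. j \<in> J \<Longrightarrow> norm (y j) \<le> 1"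
  shows "norm (\<Sum>i\<in>I. \<Sum>j\<in>J. x i * y j * X i j) \<le> B"
  using assms unfolding bilinear_bound_def by blast

lemma bilinear_bound_nonneg: "bilinear_bound I J X B \<Longrightarrow> 0 \<le> B"
  using bilinear_boundD[of I J X B "\<lambda>_. 0" "\<lambda>_. 0"] by simp

lemma bilinear_bound_mono: "bilinear_bound I J X B \<Longrightarrow> B \<le> B' \<Longrightarrow> bilinear_bound I J X B'"
  unfolding bilinear_bound_def by (meson order_trans)

lemma bilinear_bound_cong:
  fixes X Y :: "'i \<Rightarrow> 'j \<Rightarrow> 'k::real_normed_field"
  assumes "\<And>i j. i \<in> I \<Longrightarrow> j \<in> J \<Longrightarrow> X i j = Y i j"
  shows "bilinear_bound I J X B \<longleftrightarrow> bilinear_bound I J Y B"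
proof -
  have "(\<Sum>i\<in>I. \<Sum>j\<in>J. x i * y j * X i j) = (\<Sum>i\<in>I. \<Sum>j\<in>J. x i * y j * Y i j)" for x :: "'i \<Rightarrow> 'k" and y :: "'j \<Rightarrow> 'k"
    using assms by (intro sum.cong refl) simp
  then show ?thesis unfolding bilinear_bound_def by simp
qed

lemma bilinear_bound_zero: "bilinear_bound I J (\<lambda>_ _. 0) 0"
  unfolding bilinear_bound_def by simp

lemma bilinear_bound_add:
  fixes X Y :: "'i \<Rightarrow> 'j \<Rightarrow> 'k::real_normed_field"
  assumes "bilinear_bound I J X B" "bilinear_bound I J Y B'"
  shows "bilinear_bound I J (\<lambda>i j. X i j + Y i j) (B + B')"
  unfolding bilinear_bound_def
proof (intro allI impI)
  fix x :: "'i \<Rightarrow> 'k" and y :: "'j \<Rightarrow> 'k" assume xy: "(\<forall>i\<in>I. norm (x i) \<le> 1) \<and> (\<forall>j\<in>J. norm (y j) \<le> 1)"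
  have "(\<Sum>i\<in>I. \<Sum>j\<in>J. x i * y j * (X i j + Y i j)) =
      (\<Sum>i\<in>I. \<Sum>j\<in>J. x i * y j * X i j) + (\<Sum>i\<in>I. \<Sum>j\<in>J. x i * y j * Y i j)"
    by (simp add: distrib_left sum.distrib)
  also have "norm \<dots> \<le> B + B'"
    using xy assms by (intro norm_triangle_mono) (auto intro: bilinear_boundD)
  finally show "norm (\<Sum>i\<in>I. \<Sum>j\<in>J. x i * y j * (X i j + Y i j)) \<le> B + B'" .
qed

lemma bilinear_bound_sum:
  assumes "finite A" "\<And>a. a \<in> A \<Longrightarrow> bilinear_bound I J (X a) (B a)"
  shows "bilinear_bound I J (\<lambda>i j. \<Sum>a\<in>A. X a i j) (\<Sum>a\<in>A. B a)"
  using assms by (induction A rule: finite_induct) (auto intro: bilinear_bound_zero bilinear_bound_add)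

text \<open>Row and column factors are absorbed into the test vectors: divided by \<open>a\<close>
  and \<open>b\<close>, the modified vectors stay in the unit balls.\<close>

lemma bilinear_bound_scale:
  fixes X :: "'i \<Rightarrow> 'j \<Rightarrow> 'k::real_normed_field"
  assumes X: "bilinear_bound I J X B"
    and a: "0 < a" "\<And>i. i \<in> I \<Longrightarrow> norm (\<alpha> i) \<le> a"
    and b: "0 < b" "\<And>j. j \<in> J \<Longrightarrow> norm (\<beta> j) \<le> b"
  shows "bilinear_bound I J (\<lambda>i j. \<alpha> i * \<beta> j * X i j) (a * b * B)"
  unfolding bilinear_bound_def
proof (intro allI impI)
  fix x :: "'i \<Rightarrow> 'k" and y :: "'j \<Rightarrow> 'k" assume xy: "(\<forall>i\<in>I. norm (x i) \<le> 1) \<and> (\<forall>j\<in>J. norm (y j) \<le> 1)"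
  have unit: "norm (t * r / of_real e) \<le> 1" if "norm t \<le> 1" "norm r \<le> e" "0 < e" for t r :: 'k and e
    using that mult_mono[of "norm t" 1 "norm r" e] by (simp add: norm_mult norm_divide)
  have "norm (\<Sum>i\<in>I. \<Sum>j\<in>J. (x i * \<alpha> i / of_real a) * (y j * \<beta> j / of_real b) * X i j) \<le> B"
    using xy a b by (intro bilinear_boundD[OF X] unit) auto
  moreover have "(\<Sum>i\<in>I. \<Sum>j\<in>J. x i * y j * (\<alpha> i * \<beta> j * X i j)) = of_real (a * b) *
      (\<Sum>i\<in>I. \<Sum>j\<in>J. (x i * \<alpha> i / of_real a) * (y j * \<beta> j / of_real b) * X i j)"
    using a b by (simp add: sum_distrib_left field_simps)
  ultimately show "norm (\<Sum>i\<in>I. \<Sum>j\<in>J. x i * y j * (\<alpha> i * \<beta> j * X i j)) \<le> a * b * B"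
    using a b by (simp add: norm_mult mult_left_mono)
qed

lemma bilinear_bound_minus:
  assumes "bilinear_bound I J X B"
  shows "bilinear_bound I J (\<lambda>i j. - X i j) B"
  using bilinear_bound_scale[OF assms, of 1 "\<lambda>_. -1" 1 "\<lambda>_. 1"] by simp

text \<open>
  The entries with equal labels are extracted by averaging over signs: changing the sign of the rows
  and of the columns with label \<open>v\<close> and taking the mean removes the entries of which exactly one of
  the two labels is \<open>v\<close>.
\<close>

lemma bilinear_bound_block:
  fixes X :: "'i \<Rightarrow> 'j \<Rightarrow> 'k::real_normed_field"
  assumes "finite I" "bilinear_bound I J X B"
  shows "bilinear_bound I J (\<lambda>i j. if p i = s j then X i j else 0) B"
proof -
  \<comment> \<open>Induction over the labels treated so far: an entry survives the treatment of
    \<open>V\<close> iff each label in \<open>V\<close> is carried by both its row and its column or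
    by neither.\<close>
  have "bilinear_bound I J (\<lambda>i j. if \<forall>v\<in>V. (p i = v) = (s j = v) then X i j else 0) B"
    if "finite V" for V
    using that
  proof (induction V rule: finite_induct)
    case empty
    then show ?case using assms by simp
  next
    case (insert v V)
    let ?Y = "\<lambda>i j. if \<forall>v\<in>V. (p i = v) = (s j = v) then X i j else 0"
    let ?e = "\<lambda>P. if P then -1 else 1 :: 'k"
    have "bilinear_bound I J (\<lambda>i j. ?e (p i = v) * ?e (s j = v) * ?Y i j) (1 * 1 * B)"
      by (rule bilinear_bound_scale[OF insert.IH]) auto
    from bilinear_bound_add[OF insert.IH this]
    have "bilinear_bound I J (\<lambda>i j. ?Y i j + ?e (p i = v) * ?e (s j = v) * ?Y i j) (B + B)"
      by simp
    from bilinear_bound_scale[OF this, of "1/2" "\<lambda>_. 1/2" 1 "\<lambda>_. 1"]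
    have "bilinear_bound I J (\<lambda>i j. (1/2) * (?Y i j + ?e (p i = v) * ?e (s j = v) * ?Y i j)) B"
      by (simp add: norm_divide)
    moreover have "(1/2) * (?Y i j + ?e (p i = v) * ?e (s j = v) * ?Y i j) =
        (if \<forall>v\<in>insert v V. (p i = v) = (s j = v) then X i j else 0)" for i j
      by simp
    ultimately show ?case by simp
  qed
  \<comment> \<open>When \<open>V\<close> consists of all row labels, taking \<open>v = p i\<close>
    forces \<open>s j = p i\<close>, so exactly the entries with equal labels remain.\<close>
  from this[OF finite_imageI[OF assms(1)], of p] show ?thesis
    by (elim iffD1[OF bilinear_bound_cong, rotated]) auto
qed

text \<open>
  Triangular truncation is unbounded on bilinear forms in general. Here it is harmless, because the
  diagonal \<open>s q j - p q i = d\<close> has a bound \<open>2 ^ - d * D\<close>, which is summable in \<open>d\<close>. The number \<open>n\<close>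
  serves to turn the decay \<open>2 ^ - Max d\<close> into a product over \<open>K\<close>.
\<close>

lemma bilinear_bound_truncate:
  fixes p :: "'q \<Rightarrow> 'i \<Rightarrow> int" and s :: "'q \<Rightarrow> 'j \<Rightarrow> int"
    and X :: "'i \<Rightarrow> 'j \<Rightarrow> 'k::real_normed_field"
  assumes fin: "finite I" "finite J" and K: "finite K" "K \<noteq> {}" "card K \<le> n"
    and X: "\<And>q. q \<in> K \<Longrightarrow> bilinear_bound I J
      (\<lambda>i j. if v q i \<and> w q j then of_real (2 powi (s q j - p q i)) * X i j else 0) D"
  shows "bilinear_bound I J (\<lambda>i j. if \<forall>q\<in>K. v q i \<and> w q j \<and> p q i \<le> s q j then X i j else 0)
    ((1 / (1 - root n (1 / 2))) ^ n * D)"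
proof -
  define \<rho> where "\<rho> = root n (1 / 2)"
  have n: "n > 0" using K by (metis card_gt_0_iff gr0I le_zero_eq)
  have \<rho>: "0 < \<rho>" "\<rho> < 1" "\<rho> ^ n = 1 / 2"
    using n by (auto simp: \<rho>_def)
  have D: "0 \<le> D" using X K bilinear_bound_nonneg by blast
  \<comment> \<open>\<open>Y d\<close> is the part of \<open>X\<close> on which the difference
    \<open>s q j - p q i\<close> equals \<open>d q\<close> simultaneously for all \<open>q\<close>
    in \<open>K\<close>. These parts have disjoint supports.\<close>
  define Y where "Y d i j = (if \<forall>q\<in>K. v q i \<and> w q j \<and> p q i + int (d q) = s q j then X i j else 0)"
    for d i j
  have Y: "bilinear_bound I J (Y d) ((\<Prod>q\<in>K. \<rho> ^ d q) * D)" for d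
  proof -
    \<comment> \<open>Of the hypotheses for \<open>K\<close> only the one with the largest
      \<open>d q\<close> is used, since it gives the strongest decay.\<close>
    obtain q where q: "q \<in> K" "\<And>q'. q' \<in> K \<Longrightarrow> d q' \<le> d q"
      using K obtains_MAX[of K d] by (metis Max_ge finite_imageI imageI)
    let ?Z = "\<lambda>i j. if v q i \<and> w q j then of_real (2 powi (s q j - p q i)) * X i j else 0"
    \<comment> \<open>The labels are tuples indexed by \<open>K\<close>, restricted so that equality
      of functions means equality on \<open>K\<close>. A single block contraction then cuts out all
      the diagonals at once.\<close>
    have "bilinear_bound I J (\<lambda>i j. if (\<lambda>q\<in>K. p q i + int (d q)) = (\<lambda>q\<in>K. s q j) then ?Z i j else 0) D"
      by (rule bilinear_bound_block[OF fin(1) X[OF q(1)]])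
    \<comment> \<open>On the chosen diagonal the weight in \<open>?Z\<close> equals
      \<open>2 ^ d q\<close> and is cancelled by the row factor \<open>(1/2) ^ d q\<close>. The
      indicator factors impose \<open>v\<close> and \<open>w\<close> for all of
      \<open>K\<close>.\<close>
    from bilinear_bound_scale[OF this, of "(1/2) ^ d q" "\<lambda>i. if \<forall>q\<in>K. v q i then (1/2) ^ d q else 0"
        1 "\<lambda>j. if \<forall>q\<in>K. w q j then 1 else 0"]
    have "bilinear_bound I J (\<lambda>i j. (if \<forall>q\<in>K. v q i then (1/2) ^ d q else 0) *
        (if \<forall>q\<in>K. w q j then 1 else 0) *
        (if (\<lambda>q\<in>K. p q i + int (d q)) = (\<lambda>q\<in>K. s q j) then ?Z i j else 0)) ((1/2) ^ d q * D)"
      by (simp add: norm_power norm_divide)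
    moreover have "(\<lambda>q\<in>K. p q i + int (d q)) = (\<lambda>q\<in>K. s q j) \<longleftrightarrow> (\<forall>q\<in>K. p q i + int (d q) = s q j)" for i j
      by (auto simp: restrict_def fun_eq_iff)
    moreover have "p q i + int (d q) = s q j \<Longrightarrow> 2 powi (s q j - p q i) = (2::real) ^ d q" for i j
      by (smt (verit) power_int_of_nat)
    ultimately have "bilinear_bound I J (Y d) ((1/2) ^ d q * D)"
      by (elim iffD1[OF bilinear_bound_cong, rotated])
        (auto simp: Y_def q(1) power_divide)
    \<comment> \<open>The maximum is at least the sum divided by \<open>n\<close>, and
      \<open>\<rho> ^ n = 1 / 2\<close>. Decay in the maximum thus becomes decay in every coordinate
      of \<open>d\<close>.\<close>
    moreover have "(1/2) ^ d q \<le> (\<Prod>q\<in>K. \<rho> ^ d q)"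
    proof -
      have "(\<Sum>q\<in>K. d q) \<le> (\<Sum>q'\<in>K. d q)" using q(2) by (rule sum_mono)
      also have "\<dots> \<le> n * d q" using K(3) by simp
      finally have "\<rho> ^ (n * d q) \<le> \<rho> ^ (\<Sum>q\<in>K. d q)" using \<rho> by (intro power_decreasing) auto
      then show ?thesis by (simp add: power_mult \<rho> power_sum)
    qed
    ultimately show ?thesis using D by (blast intro: bilinear_bound_mono mult_right_mono)
  qed
  \<comment> \<open>\<open>L\<close> exceeds every difference that occurs, so finitely many tuples
    account for all pairs.\<close>
  define L where "L = (\<Sum>q\<in>K. \<Sum>i\<in>I. \<Sum>j\<in>J. nat (s q j - p q i)) + 1"
  have L: "nat (s q j - p q i) < L" if "q \<in> K" "i \<in> I" "j \<in> J" for q i j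
  proof -
    have "nat (s q j - p q i) \<le> (\<Sum>j\<in>J. nat (s q j - p q i))"
      using that fin by (intro member_le_sum) auto
    also have "\<dots> \<le> (\<Sum>i\<in>I. \<Sum>j\<in>J. nat (s q j - p q i))"
      using that fin by (intro member_le_sum[where f="\<lambda>i. \<Sum>j\<in>J. nat (s q j - p q i)"]) auto
    also have "\<dots> \<le> (\<Sum>q\<in>K. \<Sum>i\<in>I. \<Sum>j\<in>J. nat (s q j - p q i))"
      using that K by (intro member_le_sum[where f="\<lambda>q. \<Sum>i\<in>I. \<Sum>j\<in>J. nat (s q j - p q i)"]) auto
    finally show ?thesis by (simp add: L_def)
  qed
  let ?P = "PiE K (\<lambda>_. {..<L})"
  have P: "finite ?P" using K by (intro finite_PiE) auto
  \<comment> \<open>The sum over tuples factors into truncated geometric series, one for each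
    element of \<open>K\<close>.\<close>
  have "(\<Sum>d\<in>?P. (\<Prod>q\<in>K. \<rho> ^ d q) * D) = (\<Prod>q\<in>K. \<Sum>a<L. \<rho> ^ a) * D"
    by (subst prod_sum_PiE) (use K in \<open>simp_all add: sum_distrib_right del: prod_constant\<close>)
  also have "\<dots> \<le> (1 / (1 - \<rho>)) ^ n * D"
  proof -
    have "(\<Sum>a<L. \<rho> ^ a) \<le> 1 / (1 - \<rho>)"
      using \<rho> by (subst sum_gp_strict) (auto simp: divide_right_mono)
    then have "(\<Prod>q\<in>K. \<Sum>a<L. \<rho> ^ a) \<le> (1 / (1 - \<rho>)) ^ card K"
      using \<rho> by (simp add: power_mono sum_nonneg)
    also have "\<dots> \<le> (1 / (1 - \<rho>)) ^ n" using \<rho> K by (intro power_increasing) auto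
    finally show ?thesis using D by (rule mult_right_mono)
  qed
  finally have "bilinear_bound I J (\<lambda>i j. \<Sum>d\<in>?P. Y d i j) ((1 / (1 - \<rho>)) ^ n * D)"
    by (rule bilinear_bound_mono[OF bilinear_bound_sum[OF P Y]])
  moreover have "(\<Sum>d\<in>?P. Y d i j) = (if \<forall>q\<in>K. v q i \<and> w q j \<and> p q i \<le> s q j then X i j else 0)"
    if ij: "i \<in> I" "j \<in> J" for i j
  proof (cases "\<forall>q\<in>K. v q i \<and> w q j \<and> p q i \<le> s q j")
    case True
    \<comment> \<open>Exactly one tuple contributes at the given pair, namely that of the actual
      differences, which are nonnegative in this case.\<close>
    let ?d = "\<lambda>q\<in>K. nat (s q j - p q i)"
    have "Y d i j = (if d = ?d then X i j else 0)" if "d \<in> ?P" for d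
    proof -
      have "d = ?d \<longleftrightarrow> (\<forall>q\<in>K. p q i + int (d q) = s q j)"
        using that True by (fastforce simp: fun_eq_iff PiE_def extensional_def restrict_def)
      then show ?thesis using True by (simp add: Y_def)
    qed
    then have "(\<Sum>d\<in>?P. Y d i j) = (\<Sum>d\<in>?P. if d = ?d then X i j else 0)" by (rule sum.cong[OF refl])
    also have "\<dots> = X i j" using P L ij by (subst sum.delta) auto
    finally show ?thesis using True by simp
  next
    case False
    then obtain q where "q \<in> K" "\<not> (v q i \<and> w q j \<and> p q i \<le> s q j)" by blast
    then have "Y d i j = 0" for d unfolding Y_def by (intro if_not_P notI) (auto dest!: bspec)
    then show ?thesis by (simp only: False if_False sum.neutral_const)
  qed
  ultimately show ?thesis unfolding \<rho>_def by (elim iffD1[OF bilinear_bound_cong, rotated]) simp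
qed

text \<open>Each \<open>q\<close> defines a set of index pairs, and together these sets cover the
  support of \<open>X\<close>. Inclusion-exclusion expresses the indicator of the union by
  \<open>2 ^ card Q - 1\<close> intersections, on each of which truncation has the same
  bound.\<close>

lemma bilinear_bound_dominated:
  fixes p :: "'q \<Rightarrow> 'i \<Rightarrow> int" and s :: "'q \<Rightarrow> 'j \<Rightarrow> int"
    and X :: "'i \<Rightarrow> 'j \<Rightarrow> 'k::real_normed_field"
  assumes fin: "finite I" "finite J" and Q: "finite Q" and D: "0 \<le> D"
    and X: "\<And>q. q \<in> Q \<Longrightarrow> bilinear_bound I J
      (\<lambda>i j. if v q i \<and> w q j then of_real (2 powi (s q j - p q i)) * X i j else 0) D"
    and ex: "\<And>i j. i \<in> I \<Longrightarrow> j \<in> J \<Longrightarrow> X i j \<noteq> 0 \<Longrightarrow> \<exists>q\<in>Q. v q i \<and> w q j \<and> p q i \<le> s q j"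
  shows "bilinear_bound I J X (2 ^ card Q * ((1 / (1 - root (card Q) (1 / 2))) ^ card Q * D))"
proof -
  define B where "B = (1 / (1 - root (card Q) (1 / 2))) ^ card Q * D"
  let ?g = "\<lambda>q i j. v q i \<and> w q j \<and> p q i \<le> s q j"
  have trunc: "bilinear_bound I J (\<lambda>i j. if \<forall>q\<in>K. ?g q i j then X i j else 0) B"
    if "K \<subseteq> Q" "K \<noteq> {}" for K
    unfolding B_def using that Q fin X
    by (intro bilinear_bound_truncate) (auto intro: finite_subset card_mono)
  \<comment> \<open>Generalised for the induction: the conditions for \<open>K\<close> are imposed
    in addition, so that the correction term of inclusion-exclusion is again of this form.\<close>
  have "bilinear_bound I J (\<lambda>i j. if (\<forall>q\<in>K. ?g q i j) \<and> (\<exists>q\<in>Q'. ?g q i j) then X i j else 0)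
     ((2 ^ card Q' - 1) * B)" if "finite Q'" "Q' \<subseteq> Q" "K \<subseteq> Q" for K Q'
    using that
  proof (induction Q' arbitrary: K rule: finite_induct)
    case empty
    then show ?case using bilinear_bound_zero by simp
  next
    case (insert q Q')
    let ?F = "\<lambda>K i j. if (\<forall>q\<in>K. ?g q i j) \<and> (\<exists>q\<in>Q'. ?g q i j) then X i j else 0"
    \<comment> \<open>The indicator of the enlarged union is the old one plus that of the new set
      minus that of their intersection. The last term is the induction hypothesis for
      \<open>insert q K\<close>.\<close>
    have "bilinear_bound I J (\<lambda>i j. ?F K i j + ((if \<forall>q\<in>insert q K. ?g q i j then X i j else 0) +
        - ?F (insert q K) i j)) ((2 ^ card Q' - 1) * B + (B + (2 ^ card Q' - 1) * B))"
      using insert.prems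
      by (intro bilinear_bound_add bilinear_bound_minus trunc insert.IH) auto
    moreover have "(2 ^ card Q' - 1) * B + (B + (2 ^ card Q' - 1) * B) = (2 ^ card (insert q Q') - 1) * B"
      using insert.hyps by (simp add: algebra_simps)
    ultimately have "bilinear_bound I J (\<lambda>i j. ?F K i j + ((if \<forall>q\<in>insert q K. ?g q i j then X i j else 0) +
        - ?F (insert q K) i j)) ((2 ^ card (insert q Q') - 1) * B)"
      by simp
    moreover have "?F K i j + ((if \<forall>q\<in>insert q K. ?g q i j then X i j else 0) + - ?F (insert q K) i j) =
        (if (\<forall>q\<in>K. ?g q i j) \<and> (\<exists>q\<in>insert q Q'. ?g q i j) then X i j else 0)" for i j
    proof -
      have "(if A \<and> E then x else 0) + ((if G \<and> A then x else 0) + - (if (G \<and> A) \<and> E then x else 0)) =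
          (if A \<and> (G \<or> E) then x else 0)" for A E G and x :: 'k
        by (cases A; cases E; cases G) simp_all
      from this[of "\<forall>q\<in>K. ?g q i j" "\<exists>q\<in>Q'. ?g q i j" "X i j" "?g q i j"] show ?thesis
        by (simp only: Set.ball_simps(7) Set.bex_simps(5))
    qed
    ultimately show ?case by (simp only:)
  qed
  from this[OF Q subset_refl empty_subsetI]
  have "bilinear_bound I J X ((2 ^ card Q - 1) * B)"
    using ex by (elim iffD1[OF bilinear_bound_cong, rotated]) auto
  \<comment> \<open>Allows the factor \<open>2 ^ card Q - 1\<close> to be enlarged to
    \<open>2 ^ card Q\<close>. For empty \<open>Q\<close> the power is 1 and \<open>B\<close> equals
    \<open>D\<close>.\<close>
  moreover have "0 \<le> B"
  proof (cases "card Q = 0")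
    case False
    then have "root (card Q) (1/2) \<le> root (card Q) 1" by (subst real_root_le_iff) auto
    then show ?thesis using D False by (simp add: B_def)
  qed (use D in \<open>simp add: B_def\<close>)
  ultimately show ?thesis unfolding B_def[symmetric]
    by (elim bilinear_bound_mono) (simp add: mult_right_mono)
qed

section \<open>Bilinear forms as maps from sup norms to sum norms\<close>

lemma norm_sum_signs:
  fixes z :: "'j \<Rightarrow> 'k::real_normed_field"
  obtains \<eta> :: "'j \<Rightarrow> 'k" where "\<And>j. norm (\<eta> j) \<le> 1" "\<And>j. \<eta> j * z j = of_real (norm (z j))"
proof
  \<comment> \<open>The factor is the conjugate phase of \<open>z j\<close>, with value 0 where
    \<open>z j\<close> vanishes.\<close>
  show "norm (if z j = 0 then 0 else of_real (norm (z j)) / z j) \<le> 1" for j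
    by (simp add: norm_divide)
qed auto

text \<open>Test the form against the constant 1 on \<open>I\<close> and the conjugate phases of the
  inner sums on \<open>J\<close>.\<close>

lemma bilinear_bound_row_sum:
  fixes X :: "'i \<Rightarrow> 'j \<Rightarrow> 'k::real_normed_field"
  assumes X: "bilinear_bound I J X B"
  shows "(\<Sum>j\<in>J. norm (\<Sum>i\<in>I. X i j)) \<le> B"
proof -
  obtain \<eta> where \<eta>: "\<And>j. norm (\<eta> j) \<le> 1" "\<And>j. \<eta> j * (\<Sum>i\<in>I. X i j) = of_real (norm (\<Sum>i\<in>I. X i j))"
    using norm_sum_signs[of "\<lambda>j. \<Sum>i\<in>I. X i j"] by blast
  have "(\<Sum>i\<in>I. \<Sum>j\<in>J. 1 * \<eta> j * X i j) = (\<Sum>j\<in>J. \<eta> j * (\<Sum>i\<in>I. X i j))"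
    by (subst sum.swap) (simp add: sum_distrib_left)
  also have "\<dots> = of_real (\<Sum>j\<in>J. norm (\<Sum>i\<in>I. X i j))" by (simp add: \<eta>(2))
  finally have "norm (of_real (\<Sum>j\<in>J. norm (\<Sum>i\<in>I. X i j)) :: 'k) \<le> B"
    using bilinear_boundD[OF X, of "\<lambda>_. 1" \<eta>] \<eta>(1) by simp
  then show ?thesis unfolding norm_of_real by linarith
qed

lemma bilinear_bound_if_rowsum:
  fixes X :: "'i \<Rightarrow> 'j \<Rightarrow> 'k::real_normed_field"
  assumes "\<And>x. (\<And>i. i \<in> I \<Longrightarrow> norm (x i) \<le> 1) \<Longrightarrow> (\<Sum>j\<in>J. norm (\<Sum>i\<in>I. x i * X i j)) \<le> B"
  shows "bilinear_bound I J X B"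
  unfolding bilinear_bound_def
proof (intro allI impI)
  fix x :: "'i \<Rightarrow> 'k" and y :: "'j \<Rightarrow> 'k"
  assume xy: "(\<forall>i\<in>I. norm (x i) \<le> 1) \<and> (\<forall>j\<in>J. norm (y j) \<le> 1)"
  have "(\<Sum>i\<in>I. \<Sum>j\<in>J. x i * y j * X i j) = (\<Sum>j\<in>J. y j * (\<Sum>i\<in>I. x i * X i j))"
    by (subst sum.swap) (simp add: sum_distrib_left mult_ac)
  also have "norm \<dots> \<le> (\<Sum>j\<in>J. norm (\<Sum>i\<in>I. x i * X i j))"
    using xy by (intro sum_norm_le) (simp add: norm_mult mult_left_le_one_le)
  also have "\<dots> \<le> B" using assms xy by blast
  finally show "norm (\<Sum>i\<in>I. \<Sum>j\<in>J. x i * y j * X i j) \<le> B" .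
qed

section \<open>Unbounded series with signs\<close>

text \<open>The product majorant makes the family absolutely summable over all pairs, where
  unordered sums may be exchanged. The remaining steps identify unordered with ordered sums.\<close>

lemma suminf_swap:
  fixes f :: "nat \<Rightarrow> nat \<Rightarrow> 'a::banach"
  assumes f: "\<And>m n. norm (f m n) \<le> a m * b n" and a: "summable a" and b: "summable b"
    and nonneg: "\<And>m. 0 \<le> a m" "\<And>n. 0 \<le> b n"
  shows "(\<Sum>m. \<Sum>n. f m n) = (\<Sum>n. \<Sum>m. f m n)"
proof -
  have ab: "a summable_on UNIV" "b summable_on UNIV"
    using a b nonneg by (auto intro: norm_summable_imp_summable_on)
  have "(\<lambda>(m, n). a m * b n) summable_on UNIV \<times> UNIV"
    using ab nonneg by (intro summable_on_SigmaI[where g = "\<lambda>m. a m * infsum b UNIV"])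
      (auto intro: has_sum_cmult_right summable_on_cmult_left)
  then have "(\<lambda>z. f (fst z) (snd z)) abs_summable_on UNIV \<times> UNIV"
    by (rule summable_on_comparison_test) (auto simp: f)
  then have *: "(\<lambda>(m, n). f m n) summable_on UNIV \<times> UNIV"
    by (simp add: case_prod_unfold abs_summable_summable)
  have row: "summable (\<lambda>n. norm (f m n))" for m
    by (rule summable_comparison_test'[of "\<lambda>n. a m * b n" 0]) (auto simp: f b intro: summable_mult)
  have col: "summable (\<lambda>m. norm (f m n))" for n
    by (rule summable_comparison_test'[of "\<lambda>m. a m * b n" 0]) (auto simp: f a intro: summable_mult2)
  have rs: "infsum (f m) UNIV = (\<Sum>n. f m n)" and rb: "norm (\<Sum>n. f m n) \<le> a m * (\<Sum>n. b n)" for m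
  proof -
    show "infsum (f m) UNIV = (\<Sum>n. f m n)"
      using row by (intro infsumI norm_summable_imp_has_sum) (auto intro: summable_sums summable_norm_cancel)
    show "norm (\<Sum>n. f m n) \<le> a m * (\<Sum>n. b n)"
      using summable_norm[OF row, of m] suminf_le[OF f row summable_mult[OF b], of m] b
      by (simp add: suminf_mult)
  qed
  have cs: "infsum (\<lambda>m. f m n) UNIV = (\<Sum>m. f m n)" and cb: "norm (\<Sum>m. f m n) \<le> (\<Sum>m. a m) * b n" for n
  proof -
    show "infsum (\<lambda>m. f m n) UNIV = (\<Sum>m. f m n)"
      using col by (intro infsumI norm_summable_imp_has_sum) (auto intro: summable_sums summable_norm_cancel)
    show "norm (\<Sum>m. f m n) \<le> (\<Sum>m. a m) * b n"
      using summable_norm[OF col, of n] suminf_le[OF f col summable_mult2[OF a], of n] a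
      by (simp add: suminf_mult2)
  qed
  have sr: "summable (\<lambda>m. norm (\<Sum>n. f m n))"
    by (rule summable_comparison_test'[of "\<lambda>m. a m * (\<Sum>n. b n)" 0]) (auto simp: rb a intro: summable_mult2)
  have sc: "summable (\<lambda>n. norm (\<Sum>m. f m n))"
    by (rule summable_comparison_test'[of "\<lambda>n. (\<Sum>m. a m) * b n" 0]) (auto simp: cb b intro: summable_mult)
  have "(\<Sum>m. \<Sum>n. f m n) = infsum (\<lambda>m. \<Sum>n. f m n) UNIV"
    using sr by (intro infsumI[symmetric] norm_summable_imp_has_sum) (auto intro: summable_sums summable_norm_cancel)
  also have "\<dots> = infsum (\<lambda>n. \<Sum>m. f m n) UNIV"
    using infsum_swap_banach[OF *] by (simp add: rs cs)
  also have "\<dots> = (\<Sum>n. \<Sum>m. f m n)"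
    using sc by (intro infsumI norm_summable_imp_has_sum) (auto intro: summable_sums summable_norm_cancel)
  finally show ?thesis .
qed

text \<open>Sign sequences for which the series stay bounded by a given number along
  \<open>M k\<close> form a closed set. Its interior is empty, because flipping one free sign moves
  the \<open>m\<close>-th series by twice the large number \<open>g m m\<close>. By Baire, countably
  many such sets do not cover the compact space of signs.\<close>

lemma unbounded_sign_series:
  fixes g :: "nat \<Rightarrow> nat \<Rightarrow> 'k::{real_normed_field, banach}" and M :: "'a \<Rightarrow> nat set"
  assumes g: "\<And>m. summable (\<lambda>l. norm (g m l))"
    and A: "countable A"
    and unbounded: "\<And>k B. k \<in> A \<Longrightarrow> \<exists>m\<in>M k. B < norm (g m m)"
  shows "\<exists>a::nat \<Rightarrow> real. (\<forall>l. a l \<in> {-1, 1}) \<and>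
    (\<forall>k\<in>A. \<forall>B. \<exists>m\<in>M k. B < norm (\<Sum>l. of_real (a l) * g m l))"
proof -
  define S where "S = {a::nat \<Rightarrow> real. \<forall>l. a l \<in> {-1, 1}}"
  define f where "f m a = (\<Sum>l. of_real (a l) * g m l)" for m and a :: "nat \<Rightarrow> real"
  have norm_S: "norm (a l) = 1" if "a \<in> S" for a l
  proof -
    have "a l = -1 \<or> a l = 1" using that by (simp add: S_def)
    then show ?thesis by auto
  qed
  have summ: "summable (\<lambda>l. of_real (a l) * g m l)" if "a \<in> S" for a m
  proof (rule summable_comparison_test'[OF g[of m], of 0])
    fix l
    have "norm (a l) = 1" using that by (rule norm_S)
    then show "norm (of_real (a l) * g m l) \<le> norm (g m l)" by (simp add: norm_mult)
  qed
  have cont: "continuous_on S (f m)" for m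
  proof -
    \<comment> \<open>The majorant \<open>norm (g m l)\<close> does not involve the signs, so
      convergence is uniform and the limit depends continuously on them.\<close>
    have "uniform_limit S (\<lambda>n a. \<Sum>l<n. of_real (a l) * g m l) (f m) sequentially"
      unfolding f_def
    proof (rule Weierstrass_m_test[OF _ g])
      fix l and a :: "nat \<Rightarrow> real" assume "a \<in> S"
      then have "norm (a l) = 1" by (rule norm_S)
      then show "norm (of_real (a l) * g m l) \<le> norm (g m l)" by (simp add: norm_mult)
    qed
    moreover have "continuous_on S (\<lambda>a. \<Sum>l<n. of_real (a l) * g m l)" for n
      by (intro continuous_intros continuous_on_subset[OF continuous_on_product_coordinates]) auto
    ultimately show ?thesis by (elim uniform_limit_theorem[rotated]) auto
  qed
  have S: "S = PiE UNIV (\<lambda>_. {-1, 1})" by (auto simp: S_def PiE_def)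
  have "compactin (product_topology (\<lambda>_::nat. euclidean) UNIV) S"
    unfolding S compactin_PiE by (auto simp: finite_imp_compact)
  then have "compact S" by (simp add: euclidean_product_topology)
  then have "compact_space (top_of_set S)"
    by (simp add: compact_space_subtopology compactin_euclidean_iff)
  moreover have "Hausdorff_space (top_of_set S)"
    by (simp add: Hausdorff_space_subtopology)
  ultimately have lc: "locally_compact_space (top_of_set S) \<and> regular_space (top_of_set S)"
    by (simp add: compact_Hausdorff_imp_regular_space compact_imp_locally_compact_space)
  define H where "H k n = {a \<in> S. \<forall>m\<in>M k. norm (f m a) \<le> real n}" for k n
  have closed: "closedin (top_of_set S) (H k n)" for k n
  proof -
    have "closedin (top_of_set S) (S \<inter> f m -` cball 0 (real n))" for m
      by (rule continuous_closedin_preimage[OF cont closed_cball])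
    then have "closedin (top_of_set S) (\<Inter>(insert S ((\<lambda>m. S \<inter> f m -` cball 0 (real n)) ` M k)))"
      by (intro closedin_Inter) auto
    also have "\<Inter>(insert S ((\<lambda>m. S \<inter> f m -` cball 0 (real n)) ` M k)) = H k n"
      by (auto simp: H_def)
    finally show ?thesis .
  qed
  have empty: "top_of_set S interior_of H k n = {}" if k: "k \<in> A" for k n
  proof (rule ccontr)
    assume "top_of_set S interior_of H k n \<noteq> {}"
    then obtain a U where U: "openin (top_of_set S) U" "U \<subseteq> H k n" "a \<in> U"
      by (auto simp: interior_of_def)
    then obtain V where V: "open V" "U = S \<inter> V" by (auto simp: openin_open)
    then obtain X where X: "a \<in> PiE UNIV X" "\<And>i. open (X i)" "finite {i. X i \<noteq> UNIV}" "PiE UNIV X \<subseteq> V"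
      using U(3) product_topology_open_contains_basis[of "\<lambda>_. euclidean" UNIV V a]
      by (auto simp: open_fun_def)
    \<comment> \<open>A basic open set restricts only finitely many signs, those with index in
      \<open>L\<close>.\<close>
    define L where "L = {i. X i \<noteq> UNIV}"
    \<comment> \<open>The diagonal values over the finite set \<open>L\<close> are bounded, so a
      larger one must occur at an index whose sign is free.\<close>
    have "\<exists>m\<in>M k. m \<notin> L \<and> real n < norm (g m m)"
    proof -
      obtain m where "m \<in> M k" "real n + (\<Sum>m\<in>L. norm (g m m)) < norm (g m m)"
        using unbounded[OF k] by blast
      moreover have "norm (g m m) \<le> (\<Sum>m\<in>L. norm (g m m))" if "m \<in> L" for m
        using that X(3) by (intro member_le_sum) (auto simp: L_def)
      moreover have "0 \<le> (\<Sum>m\<in>L. norm (g m m))" by (rule sum_nonneg) auto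
      ultimately show ?thesis by force
    qed
    then obtain m where m: "m \<in> M k" "m \<notin> L" "real n < norm (g m m)" by blast
    define a' where "a' = a(m := - a m)"
    have aS: "a \<in> S" using U V by auto
    then have a'S: "a' \<in> S" by (auto simp: S_def a'_def)
    have "a' \<in> PiE UNIV X" using X(1) m(2) by (auto simp: a'_def L_def PiE_def)
    then have "a' \<in> U" using a'S X(4) V by auto
    then have "norm (f m a) \<le> n" "norm (f m a') \<le> n" using U m(1) by (auto simp: H_def)
    \<comment> \<open>The two series differ in the summand \<open>m\<close> only. Both being bounded
      by \<open>n\<close> would force \<open>norm (g m m) \<le> n\<close>.\<close>
    moreover have "f m a - f m a' = of_real (2 * a m) * g m m"
    proof -
      have "f m a - f m a' = (\<Sum>l. of_real (a l) * g m l - of_real (a' l) * g m l)"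
        unfolding f_def by (rule suminf_diff[OF summ summ]) (use aS a'S in auto)
      also have "\<dots> = (\<Sum>l\<in>{m}. of_real (a l) * g m l - of_real (a' l) * g m l)"
        by (rule suminf_finite) (auto simp: a'_def)
      finally show ?thesis by (simp add: a'_def)
    qed
    moreover have "norm (a m) = 1" using aS by (rule norm_S)
    ultimately have "2 * norm (g m m) \<le> 2 * n"
      using norm_triangle_ineq4[of "f m a" "f m a'"] by (simp add: norm_mult)
    then show False using m(3) by simp
  qed
  have "top_of_set S interior_of (\<Union>(k,n)\<in>A\<times>UNIV. H k n) = {}"
    by (rule Baire_category_alt) (use lc A closed empty in auto)
  moreover have "top_of_set S interior_of S = S" "S \<noteq> {}"
    using interior_of_topspace[of "top_of_set S"] by (auto simp: S_def)
  ultimately have "S \<noteq> (\<Union>(k,n)\<in>A\<times>UNIV. H k n)" by auto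
  moreover have "(\<Union>(k,n)\<in>A\<times>UNIV. H k n) \<subseteq> S" by (auto simp: H_def)
  ultimately obtain a where a: "a \<in> S" "\<And>k n. k \<in> A \<Longrightarrow> a \<notin> H k n" by blast
  have "\<exists>m\<in>M k. B < norm (f m a)" if "k \<in> A" for k B
  proof -
    have "B \<le> real (nat \<lceil>B\<rceil>)" by linarith
    then show ?thesis using a(1) a(2)[OF that, of "nat \<lceil>B\<rceil>"] by (force simp: H_def not_le)
  qed
  then show ?thesis using a(1) unfolding S_def f_def by blast
qed

section \<open>Continuity in graded spaces\<close>

text \<open>Collects the vector space and seminorm axioms shared by \<open>E\<close>, the Koethe
  spaces and the scalar field.\<close>

locale graded =
  fixes E :: "('k::real_or_complex, 'e::ab_group_add) graded_space"
  assumes vector_space: "vector_space (scale E)"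
    and subspace: "module.subspace (scale E) (carrier E)"
    and seminorm: "\<And>k. seminorm_on (carrier E) (scale E) (seminorm E k)"
    and seminorm_Suc: "\<And>k x. x \<in> carrier E \<Longrightarrow> seminorm E k x \<le> seminorm E (Suc k) x"

lemma frechet_space_graded: "frechet_space E \<Longrightarrow> graded E"
  by (simp add: frechet_space_def graded_def)

context graded
begin

sublocale V: vector_space "scale E"
  by (rule vector_space)

lemma zero_mem: "0 \<in> carrier E"
  and diff_mem: "x \<in> carrier E \<Longrightarrow> y \<in> carrier E \<Longrightarrow> x - y \<in> carrier E"
  and scale_mem: "x \<in> carrier E \<Longrightarrow> scale E a x \<in> carrier E"
  using subspace V.subspace_0 V.subspace_diff V.subspace_scale by blast+

lemma seminorm_nonneg: "x \<in> carrier E \<Longrightarrow> 0 \<le> seminorm E k x"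
  and seminorm_triangle:
    "x \<in> carrier E \<Longrightarrow> y \<in> carrier E \<Longrightarrow> seminorm E k (x + y) \<le> seminorm E k x + seminorm E k y"
  and seminorm_scale: "x \<in> carrier E \<Longrightarrow> seminorm E k (scale E a x) = norm a * seminorm E k x"
  using seminorm[of k] by (auto simp: seminorm_on_def)

lemma seminorm_zero: "seminorm E k 0 = 0"
  using seminorm_scale[OF zero_mem, of k 0] by simp

lemma seminorm_diff_triangle:
  assumes "x \<in> carrier E" "y \<in> carrier E" "z \<in> carrier E"
  shows "seminorm E k (x - z) \<le> seminorm E k (x - y) + seminorm E k (y - z)"
  using seminorm_triangle[of "x - y" "y - z" k] diff_mem assms by simp

lemma seminorm_mono: "j \<le> k \<Longrightarrow> x \<in> carrier E \<Longrightarrow> seminorm E j x \<le> seminorm E k x"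
  by (rule lift_Suc_mono_le[of "\<lambda>k. seminorm E k x"]) (auto simp: seminorm_Suc)

text \<open>Since the seminorms increase, a finite intersection of balls contains a ball around each
  of its points. Hence the balls centred at a point, which are only part of the given subbasis, form
  a neighbourhood base there.\<close>

lemma openin_graded_topology:
  "openin (graded_topology E) U \<longleftrightarrow> U \<subseteq> carrier E \<and>
     (\<forall>x\<in>U. \<exists>k \<epsilon>. 0 < \<epsilon> \<and> {y \<in> carrier E. seminorm E k (y - x) < \<epsilon>} \<subseteq> U)"
proof (intro iffI conjI ballI)
  let ?S = "{{y \<in> carrier E. seminorm E k (y - x) < \<epsilon>} | k x \<epsilon>. x \<in> carrier E \<and> 0 < \<epsilon>}"
  assume "openin (graded_topology E) U"
  then have U: "generate_topology_on ?S U"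
    by (simp add: graded_topology_def openin_topology_generated_by_iff)
  have sub: "A \<subseteq> carrier E" if "generate_topology_on ?S A" for A
    using that by induction auto
  show "U \<subseteq> carrier E" by (rule sub[OF U])
  show "\<exists>k \<epsilon>. 0 < \<epsilon> \<and> {y \<in> carrier E. seminorm E k (y - x) < \<epsilon>} \<subseteq> U" if "x \<in> U" for x
    using U that
  proof (induction)
    case (Int A B)
    then obtain j d k e where *: "0 < d" "{y \<in> carrier E. seminorm E j (y - x) < d} \<subseteq> A"
      "0 < e" "{y \<in> carrier E. seminorm E k (y - x) < e} \<subseteq> B" by blast
    have x: "x \<in> carrier E" using sub[OF Int.hyps(1)] Int.prems by blast
    have "{y \<in> carrier E. seminorm E (max j k) (y - x) < min d e} \<subseteq> A \<inter> B"
    proof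
      fix y assume y: "y \<in> {y \<in> carrier E. seminorm E (max j k) (y - x) < min d e}"
      then have "seminorm E j (y - x) < d" "seminorm E k (y - x) < e"
        using seminorm_mono[of j "max j k" "y - x"] seminorm_mono[of k "max j k" "y - x"] diff_mem x by auto
      then show "y \<in> A \<inter> B" using * y by blast
    qed
    then show ?case using *(1,3) by (metis min_less_iff_conj)
  next
    case (UN K)
    then show ?case by (meson Union_iff Union_upper order_trans)
  next
    case (Basis s)
    then obtain k z \<epsilon> where s: "s = {y \<in> carrier E. seminorm E k (y - z) < \<epsilon>}" "z \<in> carrier E"
      by blast
    \<comment> \<open>The subbasic ball is centred at \<open>z\<close>; shrinking the radius by the
      distance of \<open>x\<close> from \<open>z\<close> gives a ball centred at
      \<open>x\<close>.\<close>
    have "{y \<in> carrier E. seminorm E k (y - x) < \<epsilon> - seminorm E k (x - z)} \<subseteq> s"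
      using Basis.prems s by (auto intro: le_less_trans[OF seminorm_diff_triangle[of _ x z k]])
    moreover have "0 < \<epsilon> - seminorm E k (x - z)" using Basis.prems s by simp
    ultimately show ?case by blast
  qed simp
next
  assume U: "U \<subseteq> carrier E \<and>
     (\<forall>x\<in>U. \<exists>k \<epsilon>. 0 < \<epsilon> \<and> {y \<in> carrier E. seminorm E k (y - x) < \<epsilon>} \<subseteq> U)"
  show "openin (graded_topology E) U"
  proof (subst openin_subopen, intro ballI)
    fix x assume "x \<in> U"
    then obtain k \<epsilon> where "0 < \<epsilon>" "{y \<in> carrier E. seminorm E k (y - x) < \<epsilon>} \<subseteq> U" "x \<in> carrier E"
      using U by blast
    then show "\<exists>T. openin (graded_topology E) T \<and> x \<in> T \<and> T \<subseteq> U"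
      unfolding graded_topology_def openin_topology_generated_by_iff
      by (intro exI[of _ "{y \<in> carrier E. seminorm E k (y - x) < \<epsilon>}"] conjI generate_topology_on.Basis)
        (auto simp: seminorm_zero)
  qed
qed

lemma topspace_graded_topology: "topspace (graded_topology E) = carrier E"
proof
  have "openin (graded_topology E) (carrier E)"
    unfolding openin_graded_topology using zero_less_one by blast
  then show "carrier E \<subseteq> topspace (graded_topology E)" by (rule openin_subset)
  have "openin (graded_topology E) (topspace (graded_topology E))" by simp
  then show "topspace (graded_topology E) \<subseteq> carrier E" unfolding openin_graded_topology by blast
qed

lemma openin_seminorm_ball: "x \<in> carrier E \<Longrightarrow> openin (graded_topology E) {y \<in> carrier E. seminorm E k (y - x) < \<epsilon>}"
  unfolding openin_graded_topology
proof (intro conjI ballI)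
  fix z assume x: "x \<in> carrier E" and z: "z \<in> {y \<in> carrier E. seminorm E k (y - x) < \<epsilon>}"
  have "{y \<in> carrier E. seminorm E k (y - z) < \<epsilon> - seminorm E k (z - x)} \<subseteq> {y \<in> carrier E. seminorm E k (y - x) < \<epsilon>}"
    using x z by (auto intro: le_less_trans[OF seminorm_diff_triangle[of _ z x k]])
  then show "\<exists>j \<delta>. 0 < \<delta> \<and> {y \<in> carrier E. seminorm E j (y - z) < \<delta>} \<subseteq> {y \<in> carrier E. seminorm E k (y - x) < \<epsilon>}"
    using z by (intro exI[of _ k] exI[of _ "\<epsilon> - seminorm E k (z - x)"]) auto
qed auto

end

section \<open>Continuity of linear maps as boundedness between seminorms\<close>

lemma linear_between_diff:
  assumes "graded E" "graded F" "linear_between (carrier E) (scale E) (scale F) T"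
    "x \<in> carrier E" "y \<in> carrier E"
  shows "T (x - y) = T x - T y"
proof -
  interpret E: graded E by fact
  have "T x = T ((x - y) + y)" by simp
  also have "\<dots> = T (x - y) + T y"
    using assms E.diff_mem unfolding linear_between_def by blast
  finally show ?thesis by simp
qed

text \<open>Continuity at 0 gives a ball that is mapped into the unit ball of the
  \<open>k\<close>-th seminorm, and homogeneity turns this into a bound. Conversely, a bound applied
  to differences gives continuity at every point.\<close>

lemma continuous_operators_iff_bounded:
  assumes E: "graded E" and F: "graded F"
  shows "T \<in> continuous_operators E F \<longleftrightarrow>
    T \<in> carrier E \<rightarrow> carrier F \<and> linear_between (carrier E) (scale E) (scale F) T \<and>
    (\<forall>k. \<exists>r C. 0 \<le> C \<and> (\<forall>x\<in>carrier E. seminorm F k (T x) \<le> C * seminorm E r x))"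
    (is "_ \<longleftrightarrow> ?maps \<and> ?lin \<and> ?bdd")
proof -
  interpret E: graded E by fact
  interpret F: graded F by fact
  have "continuous_map (graded_topology E) (graded_topology F) T \<longleftrightarrow> ?bdd" if maps: ?maps and lin: ?lin
  proof
    have T0: "T 0 = 0"
      using linear_between_diff[OF E F lin E.zero_mem E.zero_mem] by simp
    assume cont: "continuous_map (graded_topology E) (graded_topology F) T"
    show ?bdd
    proof
      fix k
      have "openin (graded_topology E)
          {x \<in> carrier E. T x \<in> {y \<in> carrier F. seminorm F k (y - 0) < 1}}"
        using openin_continuous_map_preimage[OF cont F.openin_seminorm_ball[OF F.zero_mem]]
        by (simp add: E.topspace_graded_topology)
      moreover have "0 \<in> {x \<in> carrier E. T x \<in> {y \<in> carrier F. seminorm F k (y - 0) < 1}}"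
        by (simp add: T0 E.zero_mem F.zero_mem F.seminorm_zero)
      ultimately obtain r \<epsilon> where r: "0 < \<epsilon>"
          "{y \<in> carrier E. seminorm E r (y - 0) < \<epsilon>} \<subseteq> {x \<in> carrier E. T x \<in> {y \<in> carrier F. seminorm F k (y - 0) < 1}}"
        unfolding E.openin_graded_topology by blast
      then have less: "seminorm F k (T x) < 1" if "x \<in> carrier E" "seminorm E r x < \<epsilon>" for x
        using that by auto
      have "seminorm F k (T x) \<le> 1 / \<epsilon> * seminorm E r x" if x: "x \<in> carrier E" for x
      proof (rule field_le_epsilon)
        fix e :: real assume e: "0 < e"
        \<comment> \<open>The seminorm of \<open>x\<close> may vanish, so \<open>x\<close> is
          normalised by a slightly larger positive number, and the excess \<open>e\<close> is
          removed at the end.\<close>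
        define d where "d = seminorm E r x + \<epsilon> * e"
        have d: "0 < d" using E.seminorm_nonneg[OF x, of r] r(1) e by (simp add: d_def add_nonneg_pos)
        have "seminorm E r (scale E (of_real (\<epsilon> / d)) x) < \<epsilon>"
          using d r(1) e unfolding E.seminorm_scale[OF x] norm_of_real
          by (simp add: divide_less_eq) (simp add: d_def)
        then have "seminorm F k (T (scale E (of_real (\<epsilon> / d)) x)) < 1"
          using less E.scale_mem x by blast
        also have "T (scale E (of_real (\<epsilon> / d)) x) = scale F (of_real (\<epsilon> / d)) (T x)"
          using lin x unfolding linear_between_def by blast
        finally have "\<epsilon> / d * seminorm F k (T x) < 1"
          using d r(1) maps x by (subst (asm) F.seminorm_scale) (auto simp: norm_divide)
        then show "seminorm F k (T x) \<le> 1 / \<epsilon> * seminorm E r x + e"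
          using d r(1) by (simp add: field_simps d_def)
      qed
      then show "\<exists>r C. 0 \<le> C \<and> (\<forall>x\<in>carrier E. seminorm F k (T x) \<le> C * seminorm E r x)"
        using r(1) by (intro exI[of _ r] exI[of _ "1 / \<epsilon>"]) auto
    qed
  next
    assume bdd: ?bdd
    show "continuous_map (graded_topology E) (graded_topology F) T"
      unfolding continuous_map E.topspace_graded_topology F.topspace_graded_topology
    proof (intro conjI allI impI)
      fix U assume U: "openin (graded_topology F) U"
      show "openin (graded_topology E) {x \<in> carrier E. T x \<in> U}"
        unfolding E.openin_graded_topology
      proof (intro conjI ballI)
        fix x assume x: "x \<in> {x \<in> carrier E. T x \<in> U}"
        then obtain k \<epsilon> where k: "0 < \<epsilon>" "{y \<in> carrier F. seminorm F k (y - T x) < \<epsilon>} \<subseteq> U"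
          using U unfolding F.openin_graded_topology by blast
        obtain r C where r: "0 \<le> C" "\<And>x. x \<in> carrier E \<Longrightarrow> seminorm F k (T x) \<le> C * seminorm E r x"
          using bdd by blast
        \<comment> \<open>The radius is divided by \<open>C + 1\<close> because \<open>C\<close> may
          be 0.\<close>
        have "y \<in> {x \<in> carrier E. T x \<in> U}"
          if y: "y \<in> carrier E" "seminorm E r (y - x) < \<epsilon> / (C + 1)" for y
        proof -
          have "seminorm F k (T y - T x) = seminorm F k (T (y - x))"
            using linear_between_diff[OF E F lin y(1)] x by simp
          also have "\<dots> \<le> C * seminorm E r (y - x)" using y x by (intro r E.diff_mem) auto
          also have "\<dots> \<le> (C + 1) * seminorm E r (y - x)"
            using E.seminorm_nonneg[of "y - x" r] E.diff_mem y x by (simp add: mult_right_mono)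
          also have "\<dots> < \<epsilon>" using y(2) r(1) by (simp add: field_simps)
          finally show ?thesis using maps y k by auto
        qed
        then show "\<exists>k d. 0 < d \<and> {y \<in> carrier E. seminorm E k (y - x) < d} \<subseteq> {x \<in> carrier E. T x \<in> U}"
          using k r(1) by (intro exI[of _ r] exI[of _ "\<epsilon> / (C + 1)"]) auto
      qed auto
    qed (use maps in auto)
  qed
  then show ?thesis unfolding continuous_operators_def by blast
qed

text \<open>The scalar field as a graded space, which makes continuous functionals a special case of
  continuous operators.\<close>

definition scalar_space :: "('k::real_or_complex, 'k) graded_space" where
  "scalar_space = \<lparr>carrier = UNIV, scale = (*), seminorm = (\<lambda>_. norm)\<rparr>"

lemma graded_scalar_space: "graded scalar_space"
proof
  interpret vector_space "(*) :: 'a \<Rightarrow> 'a \<Rightarrow> 'a" by standard (auto simp: algebra_simps)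
  show "module.subspace (scale scalar_space) (carrier (scalar_space :: ('a, 'a) graded_space))"
    by (simp add: scalar_space_def)
qed (auto simp: scalar_space_def algebra_simps seminorm_on_def norm_mult norm_triangle_ineq)

lemma graded_topology_scalar_space: "graded_topology scalar_space = euclidean"
  unfolding topology_eq graded.openin_graded_topology[OF graded_scalar_space]
  by (auto simp: scalar_space_def open_dist dist_norm subset_iff)

lemma topological_dual_iff_bounded:
  assumes "graded E"
  shows "u \<in> topological_dual E \<longleftrightarrow> linear_between (carrier E) (scale E) (*) u \<and>
    (\<exists>r C. 0 \<le> C \<and> (\<forall>x\<in>carrier E. norm (u x) \<le> C * seminorm E r x))"
proof -
  have "u \<in> topological_dual E \<longleftrightarrow> u \<in> continuous_operators E scalar_space"
    by (simp add: topological_dual_def continuous_operators_def graded_topology_scalar_space)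
      (simp add: scalar_space_def)
  then show ?thesis
    by (simp add: continuous_operators_iff_bounded[OF assms graded_scalar_space])
      (simp add: scalar_space_def)
qed

section \<open>Koethe spaces\<close>

lemma koethe_matrix_nonneg: "koethe_matrix a \<Longrightarrow> 0 \<le> a n k"
  and koethe_matrix_mono: "koethe_matrix a \<Longrightarrow> j \<le> k \<Longrightarrow> a n j \<le> a n k"
  and koethe_matrix_pos: "koethe_matrix a \<Longrightarrow> \<exists>k. 0 < a n k"
  by (auto simp: koethe_matrix_def intro: lift_Suc_mono_le[of "a n"])

lemma vector_space_pointwise: "vector_space (\<lambda>(t::'k::field) (x::nat \<Rightarrow> 'k) j. t * x j)"
  by standard (auto simp: fun_eq_iff algebra_simps)

lemma subspace_pointwise:
  "module.subspace (\<lambda>(t::'k::field) (x::nat \<Rightarrow> 'k) j. t * x j) V \<longleftrightarrow>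
     0 \<in> V \<and> (\<forall>x\<in>V. \<forall>y\<in>V. x + y \<in> V) \<and> (\<forall>t. \<forall>x\<in>V. (\<lambda>j. t * x j) \<in> V)"
proof -
  interpret vector_space "\<lambda>(t::'k) (x::nat \<Rightarrow> 'k) j. t * x j" by (rule vector_space_pointwise)
  show ?thesis by (rule subspace_def)
qed

text \<open>
  The spaces \<open>\<lambda>(C)\<close>, \<open>\<lambda>\<^sup>\<infinity>(C)\<close> and \<open>\<lambda>\<^sub>0\<^sup>\<infinity>(C)\<close> differ in the family of finite sets over which the
  supremum of the weighted sums is the seminorm: all finite sets, respectively the singletons.
\<close>

locale koethe_target =
  fixes F :: "('k::real_or_complex, nat \<Rightarrow> 'k) graded_space"
    and c :: "nat \<Rightarrow> nat \<Rightarrow> real" and \<J> :: "nat set set"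
  assumes koethe: "koethe_matrix c"
    and graded: "graded F"
    and scale_eq: "scale F = (\<lambda>t x j. t * x j)"
    and l1_subset: "carrier (koethe_l1 c) \<subseteq> carrier F"
    and finite_family: "J \<in> \<J> \<Longrightarrow> finite J"
    and family_covers: "\<exists>J\<in>\<J>. j \<in> J"
    and sum_le_seminorm: "z \<in> carrier F \<Longrightarrow> J \<in> \<J> \<Longrightarrow> (\<Sum>j\<in>J. norm (z j) * c j k) \<le> seminorm F k z"
    and seminorm_le: "z \<in> carrier F \<Longrightarrow> (\<And>J. J \<in> \<J> \<Longrightarrow> (\<Sum>j\<in>J. norm (z j) * c j k) \<le> B) \<Longrightarrow>
      seminorm F k z \<le> B"
begin

lemma coordinate_le_seminorm:
  assumes "z \<in> carrier F"
  shows "norm (z j) * c j k \<le> seminorm F k z"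
proof -
  obtain J where J: "J \<in> \<J>" "j \<in> J" using family_covers by blast
  have "norm (z j) * c j k \<le> (\<Sum>j\<in>J. norm (z j) * c j k)"
    using J finite_family koethe_matrix_nonneg[OF koethe]
    by (intro member_le_sum[where f = "\<lambda>j. norm (z j) * c j k"]) auto
  also have "\<dots> \<le> seminorm F k z" using assms J by (intro sum_le_seminorm)
  finally show ?thesis .
qed

end

section \<open>The three Koethe spaces as graded spaces\<close>

lemma koethe_l1_simps:
  "carrier (koethe_l1 a) = {x. \<forall>k. summable (\<lambda>j. norm (x j) * a j k)}"
  "scale (koethe_l1 a) = (\<lambda>t x j. t * x j)"
  "seminorm (koethe_l1 a) k x = (\<Sum>j. norm (x j) * a j k)"
  by (simp_all add: koethe_l1_def)

lemma koethe_linf_simps: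
  "carrier (koethe_linf a) = {x. \<forall>k. bdd_above (range (\<lambda>j. norm (x j) * a j k))}"
  "scale (koethe_linf a) = (\<lambda>t x j. t * x j)"
  "seminorm (koethe_linf a) k x = (SUP j. norm (x j) * a j k)"
  by (simp_all add: koethe_linf_def)

lemma koethe_c0_simps:
  "carrier (koethe_c0 a) =
     {x \<in> carrier (koethe_linf a). \<forall>k. (\<lambda>j. x j * of_real (a j k)) \<longlonglongrightarrow> 0}"
  "scale (koethe_c0 a) = (\<lambda>t x j. t * x j)"
  "seminorm (koethe_c0 a) k x = (SUP j. norm (x j) * a j k)"
  by (simp_all add: koethe_c0_def koethe_linf_simps)

lemma koethe_linf_memI: "(\<And>k. \<exists>B. \<forall>j. norm (x j) * a j k \<le> B) \<Longrightarrow> x \<in> carrier (koethe_linf a)"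
  by (auto simp: koethe_linf_simps bdd_above_def)

lemma koethe_linf_upper:
  "x \<in> carrier (koethe_linf a) \<Longrightarrow> norm (x j) * a j k \<le> seminorm (koethe_linf a) k x"
  by (auto simp: koethe_linf_simps intro: cSUP_upper)

lemma koethe_linf_least:
  "(\<And>j. norm (x j) * a j k \<le> B) \<Longrightarrow> seminorm (koethe_linf a) k x \<le> B"
  by (auto simp: koethe_linf_simps intro: cSUP_least)

lemma graded_koethe_linf:
  assumes a: "koethe_matrix a"
  shows "graded (koethe_linf a :: ('k::real_or_complex, nat \<Rightarrow> 'k) graded_space)"
proof (rule graded.intro)
  let ?F = "koethe_linf a :: ('k, nat \<Rightarrow> 'k) graded_space"
  note nn = koethe_matrix_nonneg[OF a]
  show "vector_space (scale ?F)" by (simp add: koethe_linf_simps vector_space_pointwise)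
  have add: "norm ((x + y) j) * a j k \<le> seminorm ?F k x + seminorm ?F k y"
    if "x \<in> carrier ?F" "y \<in> carrier ?F" for x y j k
  proof -
    have "norm ((x + y) j) * a j k \<le> norm (x j) * a j k + norm (y j) * a j k"
      using mult_right_mono[OF norm_triangle_ineq nn] by (simp add: distrib_right)
    then show ?thesis using koethe_linf_upper[OF that(1), of j k] koethe_linf_upper[OF that(2), of j k] by simp
  qed
  have scale: "norm (t * x j) * a j k \<le> norm t * seminorm ?F k x" if "x \<in> carrier ?F" for x t j k
    using mult_left_mono[OF koethe_linf_upper[OF that, of j k] norm_ge_zero[of t]]
    by (simp add: norm_mult mult.assoc)
  have scale_mem: "(\<lambda>j. t * x j) \<in> carrier ?F" if "x \<in> carrier ?F" for x t
    by (rule koethe_linf_memI) (rule exI, rule allI, rule scale[OF that])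
  have add_mem: "x + y \<in> carrier ?F" if "x \<in> carrier ?F" "y \<in> carrier ?F" for x y
    by (rule koethe_linf_memI) (rule exI, rule allI, rule add[OF that])
  have "0 \<in> carrier ?F" by (rule koethe_linf_memI) (auto intro: exI[of _ 0])
  then show "module.subspace (scale ?F) (carrier ?F)"
    using add_mem scale_mem unfolding koethe_linf_simps(2) subspace_pointwise by simp
  show "seminorm_on (carrier ?F) (scale ?F) (seminorm ?F k)" for k
    unfolding seminorm_on_def koethe_linf_simps(2)
  proof (intro conjI ballI allI)
    fix x assume x: "x \<in> carrier ?F"
    show nonneg: "0 \<le> seminorm ?F k x"
      using koethe_linf_upper[OF x, of 0 k] nn by (meson mult_nonneg_nonneg norm_ge_zero order_trans)
    fix t
    have "norm t * seminorm ?F k x \<le> seminorm ?F k (\<lambda>j. t * x j)"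
    proof (cases "t = 0")
      case True
      then show ?thesis by (simp add: koethe_linf_simps)
    next
      case False
      have "norm (x j) * a j k \<le> seminorm ?F k (\<lambda>j. t * x j) / norm t" for j
        using koethe_linf_upper[OF scale_mem[OF x], of t j k] False by (simp add: norm_mult field_simps)
      then have "seminorm ?F k x \<le> seminorm ?F k (\<lambda>j. t * x j) / norm t" by (rule koethe_linf_least)
      then show ?thesis using False by (simp add: field_simps)
    qed
    moreover have "seminorm ?F k (\<lambda>j. t * x j) \<le> norm t * seminorm ?F k x"
      by (rule koethe_linf_least[OF scale[OF x]])
    ultimately show "seminorm ?F k (\<lambda>j. t * x j) = norm t * seminorm ?F k x" by simp
  next
    fix x y assume "x \<in> carrier ?F" "y \<in> carrier ?F"
    then show "seminorm ?F k (x + y) \<le> seminorm ?F k x + seminorm ?F k y"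
      by (intro koethe_linf_least add)
  qed
  show "seminorm ?F k x \<le> seminorm ?F (Suc k) x" if "x \<in> carrier ?F" for k x
  proof (rule koethe_linf_least)
    fix j
    have "norm (x j) * a j k \<le> norm (x j) * a j (Suc k)"
      using koethe_matrix_mono[OF a] by (simp add: mult_left_mono)
    also have "\<dots> \<le> seminorm ?F (Suc k) x" by (rule koethe_linf_upper[OF that])
    finally show "norm (x j) * a j k \<le> seminorm ?F (Suc k) x" .
  qed
qed

lemma koethe_l1_subset_c0:
  assumes a: "koethe_matrix a"
  shows "carrier (koethe_l1 a) \<subseteq> carrier (koethe_c0 a :: ('k::real_or_complex, nat \<Rightarrow> 'k) graded_space)"
proof
  fix x :: "nat \<Rightarrow> 'k" assume "x \<in> carrier (koethe_l1 a)"
  then have summable: "summable (\<lambda>j. norm (x j) * a j k)" for k by (simp add: koethe_l1_simps)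
  have "norm (x j) * a j k \<le> (\<Sum>j. norm (x j) * a j k)" for j k
    using sum_le_suminf[OF summable, of "{j}"] koethe_matrix_nonneg[OF a] by simp
  then have "x \<in> carrier (koethe_linf a)" by (blast intro: koethe_linf_memI)
  moreover have "(\<lambda>j. x j * of_real (a j k)) \<longlonglongrightarrow> 0" for k
    using summable_LIMSEQ_zero[OF summable[of k]] koethe_matrix_nonneg[OF a]
    by (subst tendsto_norm_zero_iff[symmetric]) (simp add: norm_mult)
  ultimately show "x \<in> carrier (koethe_c0 a)" by (simp add: koethe_c0_simps)
qed

lemma koethe_target_linf:
  assumes a: "koethe_matrix a"
  shows "koethe_target (koethe_linf a :: ('k::real_or_complex, nat \<Rightarrow> 'k) graded_space) a (range (\<lambda>j. {j}))"
proof -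
  let ?F = "koethe_linf a :: ('k, nat \<Rightarrow> 'k) graded_space"
  have l1: "carrier (koethe_l1 a) \<subseteq> carrier ?F"
    using koethe_l1_subset_c0[where 'k = 'k, OF a] unfolding koethe_c0_simps(1) by blast
  have le: "seminorm ?F k z \<le> B"
    if "\<And>J. J \<in> range (\<lambda>j. {j}) \<Longrightarrow> (\<Sum>j\<in>J. norm (z j) * a j k) \<le> B" for z k B
    using that[OF rangeI] by (intro koethe_linf_least) simp
  have sum_le: "(\<Sum>j\<in>J. norm (z j) * a j k) \<le> seminorm ?F k z"
    if z: "z \<in> carrier ?F" and J: "J \<in> range (\<lambda>j. {j})" for z J k
    using J koethe_linf_upper[OF z] by (elim rangeE) simp
  show ?thesis
    by (rule koethe_target.intro[OF a graded_koethe_linf[OF a] koethe_linf_simps(2) l1 _ _ sum_le le]) auto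
qed

text \<open>The middle space is treated as a target as well: this supplies the coordinate estimates
  for its elements and the continuity of the operators constructed into it.\<close>

lemma koethe_target_c0:
  assumes a: "koethe_matrix a"
  shows "koethe_target (koethe_c0 a :: ('k::real_or_complex, nat \<Rightarrow> 'k) graded_space) a (range (\<lambda>j. {j}))"
proof -
  let ?F = "koethe_linf a :: ('k, nat \<Rightarrow> 'k) graded_space"
  let ?G = "koethe_c0 a :: ('k, nat \<Rightarrow> 'k) graded_space"
  interpret linf: koethe_target ?F a "range (\<lambda>j. {j})" by (rule koethe_target_linf[OF a])
  interpret F: graded ?F by (rule linf.graded)
  have sub: "x \<in> carrier ?G \<Longrightarrow> x \<in> carrier ?F" for x by (simp add: koethe_c0_simps)
  have eqs: "scale ?G = scale ?F" "seminorm ?G = seminorm ?F"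
    by (auto simp: koethe_c0_simps koethe_linf_simps fun_eq_iff)
  have "graded ?G"
  proof (rule graded.intro)
    have "(\<lambda>j. (x + y) j * of_real (a j k)) \<longlonglongrightarrow> 0"
      if "(\<lambda>j. x j * of_real (a j k)) \<longlonglongrightarrow> 0" "(\<lambda>j. y j * of_real (a j k)) \<longlonglongrightarrow> 0" for x y :: "nat \<Rightarrow> 'k" and k
      using tendsto_add[OF that] by (simp add: distrib_right)
    moreover have "(\<lambda>j. t * x j * of_real (a j k)) \<longlonglongrightarrow> 0"
      if "(\<lambda>j. x j * of_real (a j k)) \<longlonglongrightarrow> 0" for t and x :: "nat \<Rightarrow> 'k" and k
      using tendsto_mult_left[OF that, of t] by (simp add: mult.assoc)
    ultimately show "module.subspace (scale ?G) (carrier ?G)"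
      using F.subspace unfolding eqs koethe_linf_simps(2) subspace_pointwise
      by (simp add: koethe_c0_simps(1))
    show "seminorm_on (carrier ?G) (scale ?G) (seminorm ?G k)" for k
      using F.seminorm[of k] sub unfolding eqs seminorm_on_def by blast
  qed (use F.vector_space F.seminorm_Suc sub in \<open>auto simp: eqs\<close>)
  then show ?thesis
  proof (rule koethe_target.intro[OF a])
    show "scale ?G = (\<lambda>t x j. t * x j)" by (rule koethe_c0_simps(2))
    show "carrier (koethe_l1 a) \<subseteq> carrier ?G" by (rule koethe_l1_subset_c0[OF a])
    show "finite J" if "J \<in> range (\<lambda>j. {j})" for J :: "nat set" by (rule linf.finite_family[OF that])
    show "\<exists>J\<in>range (\<lambda>j. {j}). j \<in> J" for j :: nat by (rule linf.family_covers)
    show "(\<Sum>j\<in>J. norm (z j) * a j k) \<le> seminorm ?G k z"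
      if "z \<in> carrier ?G" "J \<in> range (\<lambda>j. {j})" for z J k
      unfolding eqs using linf.sum_le_seminorm[OF sub[OF that(1)] that(2)] .
    show "seminorm ?G k z \<le> B"
      if "z \<in> carrier ?G" "\<And>J. J \<in> range (\<lambda>j. {j}) \<Longrightarrow> (\<Sum>j\<in>J. norm (z j) * a j k) \<le> B" for z k B
      unfolding eqs using linf.seminorm_le[OF sub[OF that(1)] that(2)] .
  qed
qed

lemma koethe_target_l1:
  assumes a: "koethe_matrix a"
  shows "koethe_target (koethe_l1 a :: ('k::real_or_complex, nat \<Rightarrow> 'k) graded_space) a (Collect finite)"
proof (rule koethe_target.intro)
  let ?F = "koethe_l1 a :: ('k, nat \<Rightarrow> 'k) graded_space"
  note nn = koethe_matrix_nonneg[OF a]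
  have sumD: "summable (\<lambda>j. norm (x j) * a j k)" if "x \<in> carrier ?F" for x k
    using that by (simp add: koethe_l1_simps)
  have add_le: "norm ((x + y) j) * a j k \<le> norm (x j) * a j k + norm (y j) * a j k" for x y :: "nat \<Rightarrow> 'k" and j k
    using mult_right_mono[OF norm_triangle_ineq nn] by (simp add: distrib_right)
  have add_mem: "x + y \<in> carrier ?F" if "x \<in> carrier ?F" "y \<in> carrier ?F" for x y
    unfolding koethe_l1_simps
  proof (intro CollectI allI)
    fix k
    show "summable (\<lambda>j. norm ((x + y) j) * a j k)"
      by (rule summable_comparison_test'[OF summable_add[OF sumD[OF that(1)] sumD[OF that(2)]], of 0])
        (use add_le nn in auto)
  qed
  show "graded ?F"
  proof (rule graded.intro)
    show "vector_space (scale ?F)" by (simp add: koethe_l1_simps vector_space_pointwise)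
    show "module.subspace (scale ?F) (carrier ?F)"
      unfolding koethe_l1_simps(2) subspace_pointwise
      using add_mem by (auto simp: koethe_l1_simps norm_mult mult.assoc intro: summable_mult)
    show "seminorm_on (carrier ?F) (scale ?F) (seminorm ?F k)" for k
      unfolding seminorm_on_def
    proof (intro conjI ballI allI)
      fix x assume x: "x \<in> carrier ?F"
      show "0 \<le> seminorm ?F k x"
        unfolding koethe_l1_simps using sumD[OF x] nn by (intro suminf_nonneg) auto
      show "seminorm ?F k (scale ?F t x) = norm t * seminorm ?F k x" for t
        using suminf_mult[OF sumD[OF x, of k], of "norm t"]
        by (simp add: koethe_l1_simps norm_mult mult.assoc)
      show "seminorm ?F k (x + y) \<le> seminorm ?F k x + seminorm ?F k y" if y: "y \<in> carrier ?F" for y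
        unfolding koethe_l1_simps suminf_add[OF sumD[OF x] sumD[OF y]]
        using add_le by (rule suminf_le[OF _ sumD[OF add_mem[OF x y]] summable_add[OF sumD[OF x] sumD[OF y]]])
    qed
    show "seminorm ?F k x \<le> seminorm ?F (Suc k) x" if "x \<in> carrier ?F" for k x
      unfolding koethe_l1_simps using sumD[OF that] koethe_matrix_mono[OF a]
      by (intro suminf_le mult_left_mono) auto
  qed
  show "\<exists>J\<in>Collect finite. j \<in> J" for j :: nat by (intro bexI[of _ "{j}"]) auto
  show "(\<Sum>j\<in>J. norm (z j) * a j k) \<le> seminorm ?F k z"
    if "z \<in> carrier ?F" "J \<in> Collect finite" for z J k
    unfolding koethe_l1_simps using sumD[OF that(1)] that(2) nn by (intro sum_le_suminf) auto
  show "seminorm ?F k z \<le> B"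
    if "z \<in> carrier ?F" "\<And>J. J \<in> Collect finite \<Longrightarrow> (\<Sum>j\<in>J. norm (z j) * a j k) \<le> B" for z k B
    unfolding koethe_l1_simps using sumD[OF that(1)] that(2) by (intro suminf_le_const) auto
qed (auto simp: a koethe_l1_simps(2))

text \<open>The seminorms of \<open>\<lambda>(C)\<close> dominate those of \<open>F\<close>, so an
  operator constructed into \<open>\<lambda>(C)\<close> serves every target.\<close>

lemma (in koethe_target) continuous_operators_l1_subset:
  assumes V: "graded V"
  shows "continuous_operators V (koethe_l1 c) \<subseteq> continuous_operators V F"
proof
  interpret l1: koethe_target "koethe_l1 c :: ('k, nat \<Rightarrow> 'k) graded_space" c "Collect finite"
    by (rule koethe_target_l1[OF koethe])
  fix T assume "T \<in> continuous_operators V (koethe_l1 c)"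
  then have T: "T \<in> carrier V \<rightarrow> carrier (koethe_l1 c)"
    "linear_between (carrier V) (scale V) (scale (koethe_l1 c)) T"
    "\<And>k. \<exists>r C. 0 \<le> C \<and> (\<forall>x\<in>carrier V. seminorm (koethe_l1 c) k (T x) \<le> C * seminorm V r x)"
    by (auto simp: continuous_operators_iff_bounded[OF V l1.graded])
  have "seminorm F k z \<le> seminorm (koethe_l1 c) k z" if "z \<in> carrier (koethe_l1 c)" for k z
    using that l1_subset by (intro seminorm_le l1.sum_le_seminorm) (auto simp: finite_family)
  then have "\<exists>r C. 0 \<le> C \<and> (\<forall>x\<in>carrier V. seminorm F k (T x) \<le> C * seminorm V r x)" for k
    using T(1) T(3)[of k] by (meson PiE order_trans)
  then show "T \<in> continuous_operators V F"
    using T(1,2) l1_subset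
    by (auto simp: continuous_operators_iff_bounded[OF V graded] scale_eq koethe_l1_simps(2))
qed

section \<open>From the estimate to tameness\<close>

text \<open>The inequality of condition (3) at a single \<open>k\<close>, with \<open>r\<close> in
  the role of \<open>S k\<close> and with \<open>N\<close> and \<open>C\<close> in the roles of the
  last index and of the constant.\<close>

definition max_estimate ::
    "('k::real_or_complex, 'e::ab_group_add) graded_space \<Rightarrow> (nat \<Rightarrow> nat \<Rightarrow> real) \<Rightarrow> (nat \<Rightarrow> nat \<Rightarrow> real) \<Rightarrow>
     (nat \<Rightarrow> nat) \<Rightarrow> nat \<Rightarrow> nat \<Rightarrow> nat \<Rightarrow> real \<Rightarrow> bool" where
  "max_estimate E b c \<phi> r k N C \<longleftrightarrow>
     (\<forall>u\<in>topological_dual E. \<forall>i j.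
        dual_norm E r u * ennreal (c j k) \<le>
        ennreal C *
        max_product
          (MAX q\<in>{..N}. ennreal (c j q) / ennreal (b i (\<phi> q)))
          (MAX q\<in>{..N}. ennreal (b i q) * dual_norm E (\<phi> q) u))"

section \<open>Finite sections and the matrix of an operator\<close>

definition unit_seq :: "nat \<Rightarrow> nat \<Rightarrow> 'k::zero_neq_one" where
  "unit_seq i = (\<lambda>j. if j = i then 1 else 0)"

definition cutoff :: "nat \<Rightarrow> (nat \<Rightarrow> 'k::zero) \<Rightarrow> nat \<Rightarrow> 'k" where
  "cutoff n y = (\<lambda>i. if i < n then y i else 0)"

lemma cutoff_mem_koethe_c0: 
  fixes y :: "nat \<Rightarrow> 'k::real_or_complex"
  shows "cutoff n y \<in> carrier (koethe_c0 b)"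
  unfolding koethe_c0_simps(1)
proof (intro CollectI conjI allI)
  show "cutoff n y \<in> carrier (koethe_linf b)"
  proof (rule koethe_linf_memI)
    fix k
    have "norm (cutoff n y j) * b j k \<le> (\<Sum>j<n. \<bar>norm (y j) * b j k\<bar>)" for j
    proof (cases "j < n")
      case True
      have "norm (y j) * b j k \<le> \<bar>norm (y j) * b j k\<bar>" by simp
      also have "\<dots> \<le> (\<Sum>j<n. \<bar>norm (y j) * b j k\<bar>)"
        using True by (intro member_le_sum[where f = "\<lambda>j. \<bar>norm (y j) * b j k\<bar>"]) auto
      finally show ?thesis using True by (simp add: cutoff_def)
    qed (simp add: cutoff_def sum_nonneg)
    then show "\<exists>B. \<forall>j. norm (cutoff n y j) * b j k \<le> B" by blast
  qed
  show "(\<lambda>j. cutoff n y j * of_real (b j k)) \<longlonglongrightarrow> 0" for k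
    by (rule tendsto_eventually) (auto simp: cutoff_def eventually_sequentially intro!: exI[of _ n])
qed

lemma unit_seq_eq_cutoff: "unit_seq i = cutoff (Suc i) (unit_seq i)"
  by (auto simp: unit_seq_def cutoff_def)

lemma unit_seq_mem_koethe_c0: "unit_seq i \<in> carrier (koethe_c0 b)"
  by (subst unit_seq_eq_cutoff) (rule cutoff_mem_koethe_c0)

text \<open>Density of the finitely supported sequences: the weighted coordinates tend to 0, so the
  tail is small in sup norm. This lets a continuous operator on the middle space be handled through
  its matrix.\<close>

lemma cutoff_tendsto_koethe_c0:
  assumes y: "y \<in> carrier (koethe_c0 b :: ('k::real_or_complex, nat \<Rightarrow> 'k) graded_space)" and e: "0 < e"
    and b: "koethe_matrix b"
  shows "\<exists>n. seminorm (koethe_c0 b) q (y - cutoff n y) \<le> e"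
proof -
  have "(\<lambda>j. y j * of_real (b j q)) \<longlonglongrightarrow> 0" using y by (simp add: koethe_c0_simps)
  then obtain n where n: "\<And>j. j \<ge> n \<Longrightarrow> norm (y j * of_real (b j q)) < e"
    using e by (auto simp: LIMSEQ_iff)
  have "norm ((y - cutoff n y) j) * b j q \<le> e" for j
    using n[of j] e koethe_matrix_nonneg[OF b, of j q] by (auto simp: cutoff_def norm_mult)
  then show ?thesis by (auto simp: koethe_c0_simps intro!: exI[of _ n] cSUP_least)
qed

lemma linear_cutoff:
  assumes R: "linear_between (carrier (koethe_c0 b)) (\<lambda>t x j. t * x j) (\<lambda>t x j. t * x j) R"
  shows "R (cutoff n y) j = (\<Sum>i<n. y i * R (unit_seq i) j)"
proof (induction n)
  case 0
  \<comment> \<open>The zero sequence is written as a multiple of a unit sequence, so that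
    homogeneity yields \<open>R 0 = 0\<close>.\<close>
  have "R (\<lambda>j. 0 * unit_seq 0 j) = (\<lambda>j. 0 * R (unit_seq 0) j)"
    using R unit_seq_mem_koethe_c0 unfolding linear_between_def by blast
  then show ?case by (simp add: cutoff_def)
next
  case (Suc n)
  have eq: "cutoff (Suc n) y = cutoff n y + (\<lambda>j. y n * unit_seq n j)"
    by (auto simp: cutoff_def unit_seq_def fun_eq_iff less_Suc_eq)
  have "(\<lambda>j. y n * unit_seq n j) = cutoff (Suc n) (\<lambda>j. y n * unit_seq n j)"
    by (auto simp: cutoff_def unit_seq_def)
  then have "(\<lambda>j. y n * unit_seq n j) \<in> carrier (koethe_c0 b)"
    using cutoff_mem_koethe_c0 by metis
  then have "R (cutoff (Suc n) y) = R (cutoff n y) + R (\<lambda>j. y n * unit_seq n j)"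
    using R cutoff_mem_koethe_c0[of n y b] unfolding eq linear_between_def by blast
  moreover have "R (\<lambda>j. y n * unit_seq n j) = (\<lambda>j. y n * R (unit_seq n) j)"
    using R unit_seq_mem_koethe_c0 unfolding linear_between_def by blast
  ultimately show ?case using Suc.IH by simp
qed

text \<open>Provides the integer labels that the splitting of index pairs requires: rounding a
  positive number down to a power of 2 costs at most a factor 2.\<close>

lemma floor_log_bounds:
  fixes x :: real
  assumes "0 < x"
  shows "2 powi \<lfloor>log 2 x\<rfloor> \<le> x" "x \<le> 2 * 2 powi \<lfloor>log 2 x\<rfloor>"
proof -
  have *: "(2::real) powi n = 2 powr real_of_int n" for n by (simp add: powr_real_of_int')
  have "2 powr real_of_int \<lfloor>log 2 x\<rfloor> \<le> 2 powr (log 2 x)" by (intro powr_mono) auto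
  then show "2 powi \<lfloor>log 2 x\<rfloor> \<le> x" using assms by (simp add: *)
  have "2 powr (log 2 x) \<le> 2 powr (1 + real_of_int \<lfloor>log 2 x\<rfloor>)" by (intro powr_mono) linarith+
  then show "x \<le> 2 * 2 powi \<lfloor>log 2 x\<rfloor>" using assms by (simp add: * powr_add)
qed

text \<open>The hypothesis excludes infinite quotients, and 0 divided by 0 is 0 both in
  \<open>ennreal\<close> and in \<open>real\<close>, so the maximum is attained by a real
  quotient.\<close>

lemma MAX_ennreal_divide:
  assumes "\<And>q. q \<le> N \<Longrightarrow> 0 \<le> c q \<and> 0 \<le> b q \<and> (0 < c q \<longrightarrow> 0 < b q)"
  obtains q where "q \<le> N" "(MAX q\<in>{..N::nat}. ennreal (c q) / ennreal (b q)) = ennreal (c q / b q)"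
proof -
  have "(MAX q\<in>{..N}. ennreal (c q) / ennreal (b q)) \<in> (\<lambda>q. ennreal (c q) / ennreal (b q)) ` {..N}"
    by (rule Max_in) auto
  then obtain q where "(MAX q\<in>{..N}. ennreal (c q) / ennreal (b q)) = ennreal (c q) / ennreal (b q)" "q \<in> {..N}"
    by (rule imageE)
  then have q: "q \<le> N" "(MAX q\<in>{..N}. ennreal (c q) / ennreal (b q)) = ennreal (c q) / ennreal (b q)"
    by simp_all
  moreover have "ennreal (c q) / ennreal (b q) = ennreal (c q / b q)"
    using assms[OF q(1)] by (cases "0 < b q") (auto simp: divide_ennreal)
  ultimately show ?thesis using that by simp
qed

section \<open>Bounding a composition by bilinear forms\<close>

context koethe_target
begin

text \<open>A vector bounded by 1, divided coordinatewise by \<open>b i r\<close>, lies in the unit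
  ball of the \<open>r\<close>-th seminorm of the middle space. Continuity of \<open>R\<close> then
  bounds the weighted sums over \<open>J\<close>.\<close>

lemma bilinear_bound_operator:
  assumes b: "koethe_matrix b"
    and R: "linear_between (carrier (koethe_c0 b)) (\<lambda>t x j. t * x j) (\<lambda>t x j. t * x j) R"
      "R \<in> carrier (koethe_c0 b) \<rightarrow> carrier F"
    and D: "0 \<le> D" "\<And>y. y \<in> carrier (koethe_c0 b) \<Longrightarrow> seminorm F q (R y) \<le> D * seminorm (koethe_c0 b) r y"
    and J: "J \<in> \<J>"
  shows "bilinear_bound {..<n} J (\<lambda>i j. R (unit_seq i) j * of_real (c j q / b i r)) D"
proof (rule bilinear_bound_if_rowsum)
  fix x :: "nat \<Rightarrow> 'k" assume x: "\<And>i. i \<in> {..<n} \<Longrightarrow> norm (x i) \<le> 1"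
  \<comment> \<open>If \<open>b i r = 0\<close>, then \<open>y i = 0\<close> by the convention for
    division, in agreement with the vanishing matrix entry.\<close>
  define y where "y i = x i * of_real (1 / b i r)" for i
  have "(\<Sum>i\<in>{..<n}. x i * (R (unit_seq i) j * of_real (c j q / b i r))) = R (cutoff n y) j * of_real (c j q)" for j
    unfolding linear_cutoff[OF R(1)] sum_distrib_right
    by (intro sum.cong refl) (simp add: y_def)
  then have "(\<Sum>j\<in>J. norm (\<Sum>i\<in>{..<n}. x i * (R (unit_seq i) j * of_real (c j q / b i r)))) =
      (\<Sum>j\<in>J. norm (R (cutoff n y) j) * c j q)"
    using koethe_matrix_nonneg[OF koethe] by (simp add: norm_mult)
  also have "\<dots> \<le> seminorm F q (R (cutoff n y))"
    using R(2) J cutoff_mem_koethe_c0 by (intro sum_le_seminorm) blast+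
  also have "\<dots> \<le> D * seminorm (koethe_c0 b) r (cutoff n y)"
    by (intro D(2) cutoff_mem_koethe_c0)
  also have "\<dots> \<le> D * 1"
  proof (intro mult_left_mono D(1))
    have "norm (cutoff n y i) * b i r \<le> 1" for i
      using x[of i] koethe_matrix_nonneg[OF b, of i r]
      by (auto simp: cutoff_def y_def norm_mult norm_divide)
    then show "seminorm (koethe_c0 b) r (cutoff n y) \<le> 1"
      by (auto simp: koethe_c0_simps intro: cSUP_least)
  qed
  finally show "(\<Sum>j\<in>J. norm (\<Sum>i\<in>{..<n}. x i * (R (unit_seq i) j * of_real (c j q / b i r)))) \<le> D" by simp
qed

text \<open>Apply the bound for \<open>R\<close> to a unit sequence. The purpose is to exclude a
  vanishing \<open>b i r\<close> when the entry of \<open>R\<close> and \<open>c j q\<close> are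
  nonzero.\<close>

lemma matrix_entry_le:
  fixes R :: "(nat \<Rightarrow> 'k) \<Rightarrow> nat \<Rightarrow> 'k"
  assumes b: "koethe_matrix b" and R: "R \<in> carrier (koethe_c0 b) \<rightarrow> carrier F"
    and D: "0 \<le> D" "\<And>y. y \<in> carrier (koethe_c0 b) \<Longrightarrow> seminorm F q (R y) \<le> D * seminorm (koethe_c0 b) r y"
  shows "norm (R (unit_seq i) j) * c j q \<le> D * b i r"
proof -
  have "norm (R (unit_seq i) j) * c j q \<le> seminorm F q (R (unit_seq i))"
    using R unit_seq_mem_koethe_c0 by (intro coordinate_le_seminorm) blast
  also have "\<dots> \<le> D * seminorm (koethe_c0 b) r (unit_seq i :: nat \<Rightarrow> 'k)"
    by (intro D(2) unit_seq_mem_koethe_c0)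
  also have "\<dots> \<le> D * b i r"
    using koethe_matrix_nonneg[OF b, of i r]
    by (intro mult_left_mono D(1)) (auto simp: koethe_c0_simps unit_seq_def intro!: cSUP_least)
  finally show ?thesis .
qed

text \<open>At each nonzero entry of the matrix of \<open>R\<close>, the weight
  \<open>norm (Q x i) * c j k\<close> is dominated by that of one of finitely many bounded forms.
  Which form does so depends on the pair of indices, hence the use of
  \<open>bilinear_bound_dominated\<close>.\<close>

lemma composition_bounded_if_max_estimate:
  fixes E :: "('k, 'e::ab_group_add) graded_space"
  assumes E: "graded E" and b: "koethe_matrix b"
    and Q: "linear_between (carrier E) (scale E) (\<lambda>t x j. t * x j) Q" "Q \<in> carrier E \<rightarrow> carrier (koethe_c0 b)"
    and QD: "\<And>q x. x \<in> carrier E \<Longrightarrow> seminorm (koethe_c0 b) q (Q x) \<le> D q * seminorm E (\<phi> q) x"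
    and R: "linear_between (carrier (koethe_c0 b)) (\<lambda>t x j. t * x j) (\<lambda>t x j. t * x j) R"
      "R \<in> carrier (koethe_c0 b) \<rightarrow> carrier F"
    and RD: "\<And>q y. y \<in> carrier (koethe_c0 b) \<Longrightarrow> seminorm F q (R y) \<le> D q * seminorm (koethe_c0 b) (\<phi> q) y"
    and D: "\<And>q. 0 \<le> D q"
    and est: "max_estimate E b c \<phi> r k N C" and C: "0 < C"
  shows "\<exists>K. \<forall>x\<in>carrier E. seminorm E r x \<le> 1 \<longrightarrow> seminorm F k (R (Q x)) \<le> K"
proof -
  interpret E: graded E by fact
  interpret c0: koethe_target "koethe_c0 b :: ('k, nat \<Rightarrow> 'k) graded_space" b "range (\<lambda>j. {j})"
    by (rule koethe_target_c0[OF b])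
  interpret c0g: graded "koethe_c0 b :: ('k, nat \<Rightarrow> 'k) graded_space" by (rule c0.graded)
  interpret F: graded F by (rule graded)
  note cnn = koethe_matrix_nonneg[OF koethe] and bnn = koethe_matrix_nonneg[OF b]
  define D0 where "D0 = (\<Sum>q\<le>N. D q) + 1"
  have D0: "0 < D0" "\<And>q. q \<le> N \<Longrightarrow> D q \<le> D0"
    using D member_le_sum[of _ "{..N}" D] by (auto simp: D0_def sum_nonneg add_nonneg_pos intro!: add_increasing2)
  define K where "K = 2 ^ card {..N} * ((1 / (1 - root (card {..N}) (1 / 2))) ^ card {..N} * (2 * (C * D0) * D0))"
  have mem: "Q x \<in> carrier (koethe_c0 b)" if "x \<in> carrier E" for x
    using Q(2) that by blast
  have coord: "norm (Q x i) * b i q \<le> D q * seminorm E (\<phi> q) x" if "x \<in> carrier E" for x i q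
    using c0.coordinate_le_seminorm[OF mem[OF that], of i q] QD[OF that, of q] by linarith
  \<comment> \<open>The coordinates of \<open>Q\<close> are the functionals to which the estimate is
    applied. Their continuity comes from a column in which \<open>b i q\<close> is positive.\<close>
  have dual: "(\<lambda>x. Q x i) \<in> topological_dual E" for i
    unfolding topological_dual_iff_bounded[OF E]
  proof
    show "linear_between (carrier E) (scale E) (*) (\<lambda>x. Q x i)"
      using Q(1) by (simp add: linear_between_def)
    obtain q where q: "0 < b i q" using koethe_matrix_pos[OF b] by blast
    have "norm (Q x i) \<le> D q / b i q * seminorm E (\<phi> q) x" if "x \<in> carrier E" for x
      using coord[OF that, of i q] q by (simp add: field_simps)
    then show "\<exists>r C. 0 \<le> C \<and> (\<forall>x\<in>carrier E. norm (Q x i) \<le> C * seminorm E r x)"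
      using D[of q] q by (intro exI[of _ "\<phi> q"] exI[of _ "D q / b i q"]) auto
  qed
  have dual_le: "ennreal (b i q) * dual_norm E (\<phi> q) (\<lambda>x. Q x i) \<le> ennreal (D q)" for i q
  proof -
    have "ennreal (b i q) * ennreal (norm (Q x i)) \<le> ennreal (D q)"
      if "x \<in> carrier E" "seminorm E (\<phi> q) x \<le> 1" for x
    proof -
      have "b i q * norm (Q x i) \<le> D q"
        using coord[OF that(1), of i q] mult_left_mono[OF that(2) D[of q]] by (simp add: mult.commute)
      then show ?thesis using bnn D by (simp add: ennreal_mult[symmetric] ennreal_leI)
    qed
    then show ?thesis unfolding dual_norm_def SUP_mult_left_ennreal by (intro SUP_least) auto
  qed
  have key: "\<exists>q\<le>N. norm (Q x i) * c j k \<le> C * D0 * (c j q / b i (\<phi> q))"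
    if x: "x \<in> carrier E" "seminorm E r x \<le> 1" and r: "R (unit_seq i) j \<noteq> 0" for x i j
  proof -
    \<comment> \<open>Because the entry of \<open>R\<close> is nonzero, no quotient in the first
      maximum is infinite.\<close>
    have "0 < b i (\<phi> q)" if "0 < c j q" for q
    proof -
      have "0 < norm (R (unit_seq i) j) * c j q" using r that by simp
      also have "\<dots> \<le> D q * b i (\<phi> q)" by (rule matrix_entry_le[OF b R(2) D RD])
      finally show ?thesis using bnn[of i "\<phi> q"] by (cases "b i (\<phi> q) = 0") auto
    qed
    then obtain q where q: "q \<le> N"
      "(MAX q\<in>{..N}. ennreal (c j q) / ennreal (b i (\<phi> q))) = ennreal (c j q / b i (\<phi> q))"
      using MAX_ennreal_divide[of N "c j" "\<lambda>q. b i (\<phi> q)"] cnn bnn by blast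
    let ?M = "MAX q\<in>{..N}. ennreal (b i q) * dual_norm E (\<phi> q) (\<lambda>x. Q x i)"
    have "ennreal (b i q) * dual_norm E (\<phi> q) (\<lambda>x. Q x i) \<le> ennreal D0" if "q \<le> N" for q
      by (rule order_trans[OF dual_le ennreal_leI[OF D0(2)[OF that]]])
    then have M: "?M \<le> ennreal D0" by (intro Max.boundedI) auto
    \<comment> \<open>Both maxima are finite here, so \<open>max_product\<close> is the ordinary
      product.\<close>
    have max_le: "max_product (ennreal s) M \<le> ennreal s * ennreal D0" if "M \<le> ennreal D0" for s M
      using that by (auto simp: max_product_def top_unique intro: mult_left_mono)
    have "ennreal (norm (Q x i) * c j k) = ennreal (norm (Q x i)) * ennreal (c j k)"
      using cnn by (simp add: ennreal_mult)
    also have "\<dots> \<le> dual_norm E r (\<lambda>x. Q x i) * ennreal (c j k)"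
      unfolding dual_norm_def using x by (intro mult_right_mono SUP_upper) auto
    also have "\<dots> \<le> ennreal C * max_product (ennreal (c j q / b i (\<phi> q))) ?M"
      using est dual unfolding max_estimate_def q(2)[symmetric] by blast
    also have "\<dots> \<le> ennreal C * (ennreal (c j q / b i (\<phi> q)) * ennreal D0)"
      by (intro mult_left_mono max_le[OF M]) simp
    also have "\<dots> = ennreal (C * D0 * (c j q / b i (\<phi> q)))"
      using C D0(1) cnn bnn by (simp add: ennreal_mult[symmetric] mult_ac)
    finally have "norm (Q x i) * c j k \<le> C * D0 * (c j q / b i (\<phi> q))"
      by (rule iffD1[OF ennreal_le_iff, rotated]) (use C D0(1) cnn bnn in simp)
    then show ?thesis using q(1) by blast
  qed
  \<comment> \<open>The bound \<open>K\<close> is independent of \<open>x\<close>, of the section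
    length \<open>n\<close> and of \<open>J\<close>.\<close>
  have form: "bilinear_bound {..<n} J (\<lambda>i j. R (unit_seq i) j * (Q x i * of_real (c j k))) K"
    if x: "x \<in> carrier E" "seminorm E r x \<le> 1" and J: "J \<in> \<J>" for x n J
    unfolding K_def
  proof (rule bilinear_bound_dominated)
    \<comment> \<open>The domination is separated into a row quantity \<open>?A\<close> and a column
      quantity \<open>?G\<close>, whose rounded logarithms are the labels. The conditions
      \<open>?v\<close> and \<open>?w\<close> make these quantities positive.\<close>
    let ?v = "\<lambda>q i. 0 < b i (\<phi> q) \<and> Q x i \<noteq> 0"
    let ?w = "\<lambda>q j. 0 < c j q \<and> 0 < c j k"
    let ?A = "\<lambda>q i. norm (Q x i) * b i (\<phi> q)"
    let ?G = "\<lambda>q j. C * D0 * c j q / c j k"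
    let ?p = "\<lambda>q i. \<lfloor>log 2 (?A q i)\<rfloor>"
    let ?s = "\<lambda>q j. \<lfloor>log 2 (?G q j)\<rfloor>"
    show "finite J" using J by (rule finite_family)
    show "0 \<le> 2 * (C * D0) * D0" using C D0 by simp
    show "\<exists>q\<in>{..N}. ?v q i \<and> ?w q j \<and> ?p q i \<le> ?s q j"
      if nz: "R (unit_seq i) j * (Q x i * of_real (c j k)) \<noteq> 0" for i j
    proof -
      have ck: "0 < c j k" and qx: "0 < norm (Q x i)" using nz cnn[of j k] by auto
      obtain q where q: "q \<le> N" "norm (Q x i) * c j k \<le> C * D0 * (c j q / b i (\<phi> q))"
        using key[OF x, of i j] nz by auto
      have "0 < norm (Q x i) * c j k" using ck qx by simp
      then have "0 < C * D0 * (c j q / b i (\<phi> q))" using q(2) by linarith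
      then have pos: "0 < c j q" "0 < b i (\<phi> q)"
        using C D0(1) cnn[of j q] bnn[of i "\<phi> q"] by (auto simp: zero_less_mult_iff zero_less_divide_iff)
      then have "?A q i \<le> ?G q j" using q(2) ck by (simp add: field_simps)
      moreover have "0 < ?A q i" using pos qx by simp
      ultimately have "?p q i \<le> ?s q j" by (intro floor_mono) simp
      then show ?thesis using pos ck qx q(1) by auto
    qed
    show "bilinear_bound {..<n} J (\<lambda>i j. if ?v q i \<and> ?w q j
        then of_real (2 powi (?s q j - ?p q i)) * (R (unit_seq i) j * (Q x i * of_real (c j k))) else 0)
        (2 * (C * D0) * D0)" if "q \<in> {..N}" for q
    proof -
      \<comment> \<open>These factors turn the \<open>q\<close>-th form provided by \<open>R\<close>
        into the weighted form. Rounding accounts for the bound 2 on the rows, and the columns are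
        bounded by \<open>C * D0\<close>.\<close>
      define \<alpha> where "\<alpha> i = (if ?v q i then Q x i * of_real (b i (\<phi> q) / 2 powi ?p q i) else 0)" for i
      define \<beta> where "\<beta> j = (if ?w q j then of_real (c j k / c j q * 2 powi ?s q j) else (0::'k))" for j
      have "bilinear_bound {..<n} J (\<lambda>i j. R (unit_seq i) j * of_real (c j q / b i (\<phi> q))) D0"
        using bilinear_bound_operator[OF b R D RD J] D0(2) that by (auto intro: bilinear_bound_mono)
      moreover have "norm (\<alpha> i) \<le> 2" for i
      proof (cases "?v q i")
        case True
        then have "norm (\<alpha> i) = ?A q i / 2 powi ?p q i" by (simp add: \<alpha>_def norm_mult norm_divide norm_power_int)
        also have "\<dots> \<le> 2" using floor_log_bounds(2)[of "?A q i"] True by (simp add: divide_le_eq)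
        finally show ?thesis .
      qed (simp add: \<alpha>_def)
      moreover have "norm (\<beta> j) \<le> C * D0" for j
      proof (cases "?w q j")
        case True
        then have "norm (\<beta> j) = c j k / c j q * 2 powi ?s q j"
          unfolding \<beta>_def if_P[OF True] norm_of_real by (intro abs_of_nonneg) simp
        also have "\<dots> \<le> c j k / c j q * ?G q j"
          using True C D0 by (intro mult_left_mono floor_log_bounds(1)) auto
        also have "\<dots> = C * D0" using True by simp
        finally show ?thesis .
      next
        case False
        then show ?thesis unfolding \<beta>_def if_not_P[OF False] using C D0(1) by simp
      qed
      ultimately have "bilinear_bound {..<n} J (\<lambda>i j. \<alpha> i * \<beta> j *
          (R (unit_seq i) j * of_real (c j q / b i (\<phi> q)))) (2 * (C * D0) * D0)"
        using C D0 by (intro bilinear_bound_scale) auto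
      moreover have "\<alpha> i * \<beta> j * (R (unit_seq i) j * of_real (c j q / b i (\<phi> q))) = (if ?v q i \<and> ?w q j
        then of_real (2 powi (?s q j - ?p q i)) * (R (unit_seq i) j * (Q x i * of_real (c j k))) else 0)" for i j
        by (cases "?v q i \<and> ?w q j") (auto simp: \<alpha>_def \<beta>_def power_int_diff)
      ultimately show ?thesis by simp
    qed
  qed auto
  have "seminorm F k (R (Q x)) \<le> K" if x: "x \<in> carrier E" "seminorm E r x \<le> 1" for x
  proof (rule seminorm_le)
    show "R (Q x) \<in> carrier F" using R(2) mem[OF x(1)] by blast
    fix J assume J: "J \<in> \<J>"
    show "(\<Sum>j\<in>J. norm (R (Q x) j) * c j k) \<le> K"
    proof (rule field_le_epsilon)
      fix e :: real assume e: "0 < e"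
      \<comment> \<open>The form covers finite sections of \<open>Q x\<close> only; the remainder is
        made small in the seminorm that controls \<open>R\<close> at \<open>k\<close>. The summand 1
        keeps the denominator positive.\<close>
      obtain n where n: "seminorm (koethe_c0 b) (\<phi> k) (Q x - cutoff n (Q x)) \<le> e / (D k + 1)"
        using cutoff_tendsto_koethe_c0[OF mem[OF x(1)] _ b, of "e / (D k + 1)" "\<phi> k"] e D[of k] by (auto simp: add_nonneg_pos)
      let ?y = "cutoff n (Q x)" and ?z = "Q x - cutoff n (Q x)"
      have y: "?y \<in> carrier (koethe_c0 b)" by (rule cutoff_mem_koethe_c0)
      have z: "?z \<in> carrier (koethe_c0 b)" using c0g.diff_mem[OF mem[OF x(1)] y] .
      have "R (Q x) = R (?z + ?y)" by simp
      also have "\<dots> = R ?z + R ?y" using R(1) y z unfolding linear_between_def by blast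
      finally have split: "R (Q x) j = R ?z j + R ?y j" for j by simp
      have "(\<Sum>j\<in>J. norm (R (Q x) j) * c j k) \<le> (\<Sum>j\<in>J. norm (R ?z j) * c j k) + (\<Sum>j\<in>J. norm (R ?y j) * c j k)"
        unfolding split sum.distrib[symmetric] distrib_right[symmetric]
        by (intro sum_mono mult_right_mono norm_triangle_ineq cnn)
      also have "(\<Sum>j\<in>J. norm (R ?z j) * c j k) \<le> seminorm F k (R ?z)"
        using R(2) z J by (intro sum_le_seminorm) auto
      also have "\<dots> \<le> D k * seminorm (koethe_c0 b) (\<phi> k) ?z" by (rule RD[OF z])
      also have "\<dots> \<le> D k * (e / (D k + 1))" by (rule mult_left_mono[OF n D])
      also have "\<dots> \<le> e" using D[of k] e by (simp add: field_simps add_nonneg_pos)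
      also have "(\<Sum>j\<in>J. norm (R ?y j) * c j k) = (\<Sum>j\<in>J. norm (\<Sum>i\<in>{..<n}. R (unit_seq i) j * (Q x i * of_real (c j k))))"
      proof (rule sum.cong[OF refl])
        fix j
        have "(\<Sum>i\<in>{..<n}. R (unit_seq i) j * (Q x i * of_real (c j k))) = R ?y j * of_real (c j k)"
          unfolding linear_cutoff[OF R(1)] sum_distrib_right by (simp add: mult_ac)
        then show "norm (R ?y j) * c j k = norm (\<Sum>i\<in>{..<n}. R (unit_seq i) j * (Q x i * of_real (c j k)))"
          using cnn by (simp add: norm_mult)
      qed
      also have "\<dots> \<le> K" by (rule bilinear_bound_row_sum[OF form[OF x J]])
      finally show "(\<Sum>j\<in>J. norm (R (Q x) j) * c j k) \<le> K + e" by simp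
    qed
  qed
  then show ?thesis by blast
qed

lemma tame_factorization_if_max_estimate:
  fixes E :: "('k, 'e::ab_group_add) graded_space"
  assumes E: "graded E" and b: "koethe_matrix b" and S: "mono S"
    and est: "\<And>\<phi>. mono \<phi> \<Longrightarrow> \<exists>k0. \<forall>k\<ge>k0. \<exists>N C. C > 0 \<and> max_estimate E b c \<phi> (S k) k N C"
  shows "tame_factorization E (koethe_c0 b) F"
  unfolding tame_factorization_def
proof (intro exI[of _ S] conjI S ballI)
  interpret E: graded E by fact
  interpret c0: koethe_target "koethe_c0 b :: ('k, nat \<Rightarrow> 'k) graded_space" b "range (\<lambda>j. {j})"
    by (rule koethe_target_c0[OF b])
  interpret c0g: graded "koethe_c0 b :: ('k, nat \<Rightarrow> 'k) graded_space" by (rule c0.graded)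
  fix T assume "T \<in> factorized_operators E (koethe_c0 b) F"
  then obtain Q R where QR: "Q \<in> continuous_operators E (koethe_c0 b)" "R \<in> continuous_operators (koethe_c0 b) F"
    and T: "\<And>x. x \<in> carrier E \<Longrightarrow> T x = R (Q x)"
    by (auto simp: factorized_operators_def)
  have Q: "linear_between (carrier E) (scale E) (\<lambda>t x j. t * x j) Q" "Q \<in> carrier E \<rightarrow> carrier (koethe_c0 b)"
    "\<forall>k. \<exists>r C. 0 \<le> C \<and> (\<forall>x\<in>carrier E. seminorm (koethe_c0 b) k (Q x) \<le> C * seminorm E r x)"
    using QR(1) unfolding continuous_operators_iff_bounded[OF E c0.graded] koethe_c0_simps(2) by auto
  have R: "linear_between (carrier (koethe_c0 b)) (\<lambda>t x j. t * x j) (\<lambda>t x j. t * x j) R"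
    "R \<in> carrier (koethe_c0 b) \<rightarrow> carrier F"
    "\<forall>k. \<exists>r C. 0 \<le> C \<and> (\<forall>y\<in>carrier (koethe_c0 b). seminorm F k (R y) \<le> C * seminorm (koethe_c0 b) r y)"
    using QR(2) unfolding continuous_operators_iff_bounded[OF c0.graded graded] koethe_c0_simps(2) scale_eq by auto
  obtain r C where rC: "\<And>k. 0 \<le> C k" "\<And>k x. x \<in> carrier E \<Longrightarrow> seminorm (koethe_c0 b) k (Q x) \<le> C k * seminorm E (r k) x"
    using Q(3) by metis
  obtain r' C' where rC': "\<And>k. 0 \<le> C' k"
    "\<And>k y. y \<in> carrier (koethe_c0 b) \<Longrightarrow> seminorm F k (R y) \<le> C' k * seminorm (koethe_c0 b) (r' k) y"
    using R(3) by metis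
  \<comment> \<open>Partial sums give one nondecreasing function that majorises the continuity
    indices of both \<open>Q\<close> and \<open>R\<close>.\<close>
  define \<phi> where "\<phi> q = (\<Sum>p\<le>q. r p + r' p)" for q
  define D where "D q = C q + C' q" for q
  have "mono \<phi>" unfolding \<phi>_def by (intro monoI sum_mono2) auto
  have "r q + r' q \<le> \<phi> q" for q
    unfolding \<phi>_def by (rule member_le_sum[where f = "\<lambda>p. r p + r' p"]) auto
  then have \<phi>: "r q \<le> \<phi> q" "r' q \<le> \<phi> q" for q using add_leE by blast+
  have D: "0 \<le> D q" for q using rC(1) rC'(1) by (simp add: D_def)
  have QD: "seminorm (koethe_c0 b) q (Q x) \<le> D q * seminorm E (\<phi> q) x" if "x \<in> carrier E" for q x
    by (rule order_trans[OF rC(2)[OF that]], rule mult_mono)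
      (use rC(1) rC'(1) E.seminorm_mono[OF \<phi>(1) that] E.seminorm_nonneg[OF that] in \<open>auto simp: D_def\<close>)
  have RD: "seminorm F q (R y) \<le> D q * seminorm (koethe_c0 b) (\<phi> q) y" if "y \<in> carrier (koethe_c0 b)" for q y
    by (rule order_trans[OF rC'(2)[OF that]], rule mult_mono)
      (use rC(1) rC'(1) c0g.seminorm_mono[OF \<phi>(2) that] c0g.seminorm_nonneg[OF that] in \<open>auto simp: D_def\<close>)
  obtain k0 where k0: "\<And>k. k \<ge> k0 \<Longrightarrow> \<exists>N C. C > 0 \<and> max_estimate E b c \<phi> (S k) k N C"
    using est[OF \<open>mono \<phi>\<close>] by blast
  show "\<exists>k0. \<forall>k\<ge>k0. continuity_index E F T k \<le> S k"
  proof (intro exI[of _ k0] allI impI)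
    fix k assume "k0 \<le> k"
    then obtain N C where "0 < C" "max_estimate E b c \<phi> (S k) k N C" using k0 by blast
    then obtain K where K: "\<And>x. x \<in> carrier E \<Longrightarrow> seminorm E (S k) x \<le> 1 \<Longrightarrow> seminorm F k (R (Q x)) \<le> K"
      using composition_bounded_if_max_estimate[OF E b Q(1,2) QD R(1,2) RD D] by blast
    have "operator_norm E F k (S k) T \<le> ennreal K"
      unfolding operator_norm_def using K T by (intro SUP_least) (auto intro: ennreal_leI)
    also have "\<dots> < \<infinity>" by simp
    finally show "continuity_index E F T k \<le> S k"
      unfolding continuity_index_def by (intro cInf_lower) auto
  qed
qed

end

section \<open>From tameness to the estimate\<close>

text \<open>The finitely many exceptional \<open>l\<close> are absorbed by adding up their indices
  and constants. This is needed because the counterexamples control the column \<open>q\<close> only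
  from \<open>l = q\<close> on.\<close>

lemma uniform_bound_of_eventual:
  fixes A :: "nat \<Rightarrow> 'z \<Rightarrow> real" and p :: "nat \<Rightarrow> nat \<Rightarrow> 'z \<Rightarrow> real"
  assumes mono: "\<And>l r r' z. r \<le> r' \<Longrightarrow> z \<in> Z \<Longrightarrow> p l r z \<le> p l r' z"
    and nonneg: "\<And>l r z. z \<in> Z \<Longrightarrow> 0 \<le> p l r z"
    and tail: "\<And>l z. q \<le> l \<Longrightarrow> z \<in> Z \<Longrightarrow> A l z \<le> p l \<rho> z"
    and each: "\<And>l. \<exists>r C. 0 \<le> C \<and> (\<forall>z\<in>Z. A l z \<le> C * p l r z)"
  shows "\<exists>r C. 0 \<le> C \<and> (\<forall>l. \<forall>z\<in>Z. A l z \<le> C * p l r z)"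
proof -
  obtain r C where rC: "\<And>l. 0 \<le> C l" "\<And>l z. z \<in> Z \<Longrightarrow> A l z \<le> C l * p l (r l) z"
    using each by metis
  define r' where "r' = \<rho> + (\<Sum>l<q. r l)"
  define C' where "C' = 1 + (\<Sum>l<q. C l)"
  have sumC: "0 \<le> (\<Sum>l<q. C l)" by (intro sum_nonneg rC)
  have "A l z \<le> C' * p l r' z" if z: "z \<in> Z" for l z
  proof (cases "q \<le> l")
    case True
    have "A l z \<le> p l \<rho> z" by (rule tail[OF True z])
    also have "\<dots> \<le> p l r' z" by (rule mono[OF _ z]) (simp add: r'_def)
    also have "\<dots> \<le> C' * p l r' z"
      using nonneg[OF z, of l r'] sumC by (simp add: C'_def distrib_right)
    finally show ?thesis .
  next
    case False
    have "r l \<le> (\<Sum>l<q. r l)" "C l \<le> (\<Sum>l<q. C l)"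
      using False rC(1) by (auto intro: member_le_sum)
    then have "r l \<le> r'" "C l \<le> C'" by (auto simp: r'_def C'_def)
    then have "C l * p l (r l) z \<le> C' * p l r' z"
      using rC(1)[of l] nonneg[OF z] mono[OF _ z] by (intro mult_mono) auto
    then show ?thesis using rC(2)[OF z, of l] by linarith
  qed
  then show ?thesis using sumC by (intro exI[of _ r'] exI[of _ C']) (auto simp: C'_def)
qed

section \<open>Operators given by weighted series of functionals\<close>

lemma summable_half: "summable (\<lambda>l. (1 / 2) ^ l * B :: real)"
  by (intro summable_mult2 summable_geometric) simp

text \<open>In a column with \<open>c j q > 0\<close> the hypothesis bounds all \<open>s l z\<close>
  with \<open>J l = j\<close> uniformly, and the geometric weights give summability.\<close>

lemma series_operator_summable:
  fixes V :: "('k::real_or_complex, 'v::ab_group_add) graded_space" and s :: "nat \<Rightarrow> 'v \<Rightarrow> 'k"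
  assumes c: "koethe_matrix c" and z: "z \<in> carrier V"
    and s: "\<And>q. \<exists>r C. 0 \<le> C \<and> (\<forall>l. \<forall>z\<in>carrier V. c (J l) q * norm (s l z) \<le> C * seminorm V r z)"
  shows "summable (\<lambda>l. norm (if J l = j then (1 / 2) ^ l * s l z else 0))"
proof -
  obtain q where q: "0 < c j q" using koethe_matrix_pos[OF c] by blast
  obtain r C where rC: "\<And>l. c (J l) q * norm (s l z) \<le> C * seminorm V r z" using s[of q] z by blast
  show ?thesis
  proof (rule summable_comparison_test'[OF summable_half[of "\<bar>C * seminorm V r z\<bar> / c j q"], of 0])
    fix l
    have "norm (s l z) \<le> \<bar>C * seminorm V r z\<bar> / c j q" if "J l = j"
      using rC[of l] that q by (simp add: field_simps)
    then have "(1 / 2) ^ l * norm (s l z) \<le> (1 / 2) ^ l * (\<bar>C * seminorm V r z\<bar> / c j q)" if "J l = j"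
      using that by (intro mult_left_mono) auto
    then show "norm (norm (if J l = j then (1 / 2) ^ l * s l z else 0)) \<le> (1 / 2) ^ l * (\<bar>C * seminorm V r z\<bar> / c j q)"
      using q by (simp add: norm_mult norm_power norm_divide)
  qed
qed

text \<open>The operator sends \<open>z\<close> to the sum of \<open>2^(-l) * s l z\<close> times
  the unit sequence at \<open>J l\<close>, written coordinatewise because several \<open>l\<close>
  may share one coordinate. It yields both factors of the composition.\<close>

lemma series_operator_continuous:
  fixes V :: "('k::real_or_complex, 'v::ab_group_add) graded_space" and s :: "nat \<Rightarrow> 'v \<Rightarrow> 'k"
  assumes V: "graded V" and c: "koethe_matrix c"
    and lin: "\<And>l. linear_between (carrier V) (scale V) (*) (s l)"
    and s: "\<And>q. \<exists>r C. 0 \<le> C \<and> (\<forall>l. \<forall>z\<in>carrier V. c (J l) q * norm (s l z) \<le> C * seminorm V r z)"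
  shows "(\<lambda>z j. \<Sum>l. if J l = j then (1 / 2) ^ l * s l z else 0) \<in> continuous_operators V (koethe_l1 c)"
proof -
  interpret V: graded V by fact
  interpret l1: koethe_target "koethe_l1 c :: ('k, nat \<Rightarrow> 'k) graded_space" c "Collect finite"
    by (rule koethe_target_l1[OF c])
  let ?h = "\<lambda>j z l. if J l = j then (1 / 2) ^ l * s l z else 0"
  let ?T = "\<lambda>z j. \<Sum>l. ?h j z l"
  have norm_summable: "summable (\<lambda>l. norm (?h j z l))" if "z \<in> carrier V" for z j
    by (rule series_operator_summable[OF c that s])
  then have summ: "summable (?h j z)" if "z \<in> carrier V" for z j
    using that by (blast intro: summable_norm_cancel)
  have bound: "(\<Sum>j<n. norm (?T z j) * c j q) \<le> (\<Sum>l. (1 / 2) ^ l) * (C * seminorm V r z)"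
    if z: "z \<in> carrier V" and C: "0 \<le> C" "\<forall>l. \<forall>z\<in>carrier V. c (J l) q * norm (s l z) \<le> C * seminorm V r z"
    for z n q C r
  proof -
    have "(\<Sum>j<n. norm (?T z j) * c j q) \<le> (\<Sum>j<n. (\<Sum>l. norm (?h j z l) * c j q))"
    proof (rule sum_mono)
      fix j
      have "norm (?T z j) * c j q \<le> (\<Sum>l. norm (?h j z l)) * c j q"
        using koethe_matrix_nonneg[OF c] by (intro mult_right_mono summable_norm norm_summable z)
      then show "norm (?T z j) * c j q \<le> (\<Sum>l. norm (?h j z l) * c j q)"
        by (simp add: suminf_mult2[OF norm_summable[OF z]])
    qed
    \<comment> \<open>Each \<open>l\<close> feeds the single coordinate \<open>J l\<close>, so after
      the exchange the inner sum has at most one nonzero term and the bound is independent of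
      \<open>n\<close>.\<close>
    also have "\<dots> = (\<Sum>l. \<Sum>j<n. norm (?h j z l) * c j q)"
      by (intro suminf_sum[symmetric] summable_mult2 norm_summable z)
    also have "\<dots> \<le> (\<Sum>l. (1 / 2) ^ l * (C * seminorm V r z))"
    proof (intro suminf_le summable_sum summable_mult2 norm_summable z summable_half)
      fix l
      have "(\<Sum>j<n. norm (?h j z l) * c j q) = (\<Sum>j<n. if J l = j then (1 / 2) ^ l * (c (J l) q * norm (s l z)) else 0)"
        by (intro sum.cong) (auto simp: norm_mult norm_power norm_divide)
      also have "\<dots> \<le> (1 / 2) ^ l * (c (J l) q * norm (s l z))"
        using koethe_matrix_nonneg[OF c] by (subst sum.delta') auto
      also have "\<dots> \<le> (1 / 2) ^ l * (C * seminorm V r z)" using C z by (intro mult_left_mono) auto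
      finally show "(\<Sum>j<n. norm (?h j z l) * c j q) \<le> (1 / 2) ^ l * (C * seminorm V r z)" .
    qed (simp add: summable_geometric)
    also have "\<dots> = (\<Sum>l. (1 / 2) ^ l) * (C * seminorm V r z)"
      by (intro suminf_mult2[symmetric] summable_geometric) simp
    finally show ?thesis .
  qed
  have l1_summable: "summable (\<lambda>j. norm (?T z j) * c j q)" if z: "z \<in> carrier V" for z q
  proof -
    obtain r C where C: "0 \<le> C" "\<forall>l. \<forall>z\<in>carrier V. c (J l) q * norm (s l z) \<le> C * seminorm V r z"
      using s by blast
    show ?thesis
      using koethe_matrix_nonneg[OF c]
      by (intro summableI_nonneg_bounded[OF _ bound[OF z C]]) auto
  qed
  have maps: "?T \<in> carrier V \<rightarrow> carrier (koethe_l1 c)"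
    unfolding koethe_l1_simps using l1_summable by blast
  have linT: "linear_between (carrier V) (scale V) (scale (koethe_l1 c)) ?T"
    unfolding linear_between_def koethe_l1_simps(2)
  proof (intro conjI ballI allI)
    fix x y assume x: "x \<in> carrier V" and y: "y \<in> carrier V"
    have "?h j (x + y) l = ?h j x l + ?h j y l" for j l
      using lin[of l] x y by (simp add: linear_between_def distrib_left)
    then show "?T (x + y) = ?T x + ?T y"
      by (simp add: fun_eq_iff suminf_add[OF summ[OF x] summ[OF y]])
  next
    fix a x assume x: "x \<in> carrier V"
    have "?h j (scale V a x) l = a * ?h j x l" for j l
      using lin[of l] x by (simp add: linear_between_def)
    then show "?T (scale V a x) = (\<lambda>j. a * ?T x j)"
      by (simp add: fun_eq_iff suminf_mult[OF summ[OF x]])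
  qed
  have bdd: "\<exists>r C. 0 \<le> C \<and> (\<forall>z\<in>carrier V. seminorm (koethe_l1 c) q (?T z) \<le> C * seminorm V r z)" for q
  proof -
    obtain r C where C: "0 \<le> C" "\<forall>l. \<forall>z\<in>carrier V. c (J l) q * norm (s l z) \<le> C * seminorm V r z"
      using s by blast
    have "seminorm (koethe_l1 c) q (?T z) \<le> (\<Sum>l. (1 / 2) ^ l) * C * seminorm V r z" if "z \<in> carrier V" for z
      unfolding koethe_l1_simps using suminf_le_const[OF l1_summable[OF that] bound[OF that C]]
      by (simp add: mult.assoc)
    moreover have "0 \<le> (\<Sum>l. (1 / 2) ^ l) * C"
      using C(1) by (intro mult_nonneg_nonneg suminf_nonneg summable_geometric) auto
    ultimately show ?thesis by blast
  qed
  show ?thesis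
    using maps linT bdd unfolding continuous_operators_iff_bounded[OF V l1.graded] by blast
qed

text \<open>A violating functional is divided by a number slightly above the second maximum, and
  \<open>t\<close> is the reciprocal of a number slightly above the first. The upper bounds then
  have constant 1 and the violation has size \<open>L\<close>.\<close>

lemma not_max_estimateE:
  fixes E :: "('k::real_or_complex, 'e::ab_group_add) graded_space"
  assumes E: "graded E" and b: "koethe_matrix b" and c: "koethe_matrix c"
    and fails: "\<not> max_estimate E b c \<phi> r k N L" and L: "0 < L"
  obtains u i j x t where "u \<in> topological_dual E" "x \<in> carrier E" "seminorm E r x \<le> 1" "0 < t"
    "\<And>q z. q \<le> N \<Longrightarrow> z \<in> carrier E \<Longrightarrow> b i q * norm (u z) \<le> seminorm E (\<phi> q) z"
    "\<And>q. q \<le> N \<Longrightarrow> t * c j q \<le> b i (\<phi> q)"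
    "L < norm (u x) * (t * c j k)"
proof -
  interpret E: graded E by fact
  note bnn = koethe_matrix_nonneg[OF b] and cnn = koethe_matrix_nonneg[OF c]
  obtain u i j where u: "u \<in> topological_dual E"
    and "\<not> dual_norm E r u * ennreal (c j k) \<le> ennreal L * max_product
      (MAX q\<in>{..N}. ennreal (c j q) / ennreal (b i (\<phi> q)))
      (MAX q\<in>{..N}. ennreal (b i q) * dual_norm E (\<phi> q) u)"
    using fails unfolding max_estimate_def by blast
  moreover define M1 where "M1 = (MAX q\<in>{..N}. ennreal (c j q) / ennreal (b i (\<phi> q)))"
  moreover define M2 where "M2 = (MAX q\<in>{..N}. ennreal (b i q) * dual_norm E (\<phi> q) u)"
  ultimately have less: "ennreal L * max_product M1 M2 < dual_norm E r u * ennreal (c j k)"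
    by (simp add: not_le)
  \<comment> \<open>An infinite maximum would make the right-hand side infinite, even if the other
    one were 0, and the estimate would hold.\<close>
  have fin: "M1 \<noteq> top" "M2 \<noteq> top"
    using less L by (auto simp: max_product_def ennreal_mult_top)
  then obtain m1 m2 where m: "M1 = ennreal m1" "0 \<le> m1" "M2 = ennreal m2" "0 \<le> m2"
    by (metis ennreal_cases)
  have "ennreal (L * (m1 * m2)) < (SUP x\<in>{x \<in> carrier E. seminorm E r x \<le> 1}. ennreal (norm (u x)) * ennreal (c j k))"
    using less m L unfolding dual_norm_def by (simp add: max_product_def ennreal_mult SUP_mult_right_ennreal)
  then obtain x where x: "x \<in> carrier E" "seminorm E r x \<le> 1"
    and "ennreal (L * (m1 * m2)) < ennreal (norm (u x)) * ennreal (c j k)"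
    unfolding less_SUP_iff by blast
  then have ux: "L * (m1 * m2) < norm (u x) * c j k"
    using cnn L m by (simp add: ennreal_mult[symmetric] ennreal_less_iff)
  \<comment> \<open>The strict inequality leaves room to enlarge both maxima by some
    \<open>e > 0\<close>, which permits division also when they are 0.\<close>
  have "((\<lambda>e. L * ((m1 + e) * (m2 + e))) \<longlongrightarrow> L * ((m1 + 0) * (m2 + 0))) (at_right 0)"
    by (intro tendsto_intros)
  then have "\<forall>\<^sub>F e in at_right 0. L * ((m1 + e) * (m2 + e)) < norm (u x) * c j k"
    using ux by (intro order_tendstoD(2)) auto
  then have "\<forall>\<^sub>F e in at_right 0. L * ((m1 + e) * (m2 + e)) < norm (u x) * c j k \<and> 0 < e"
    using eventually_at_right_less by (rule eventually_conj)
  then obtain e where e: "L * ((m1 + e) * (m2 + e)) < norm (u x) * c j k" "0 < e"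
    using eventually_happens'[OF trivial_limit_at_right_real] by blast
  define u' where "u' z = of_real (1 / (m2 + e)) * u z" for z
  have norm_u': "norm (u' z) = norm (u z) / (m2 + e)" for z
    unfolding u'_def norm_mult norm_of_real using m e by simp
  show thesis
  proof
    obtain \<rho> C where \<rho>: "linear_between (carrier E) (scale E) (*) u" "0 \<le> C"
      "\<And>x. x \<in> carrier E \<Longrightarrow> norm (u x) \<le> C * seminorm E \<rho> x"
      using u unfolding topological_dual_iff_bounded[OF E] by blast
    have "norm (u' x) \<le> C / (m2 + e) * seminorm E \<rho> x" if "x \<in> carrier E" for x
      using \<rho>(3)[OF that] m e by (simp add: norm_u' divide_right_mono)
    moreover have "0 \<le> C / (m2 + e)" using \<rho>(2) m e by simp
    moreover have "linear_between (carrier E) (scale E) (*) u'"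
      using \<rho>(1) by (simp add: linear_between_def u'_def distrib_left mult.left_commute)
    ultimately show "u' \<in> topological_dual E"
      unfolding topological_dual_iff_bounded[OF E] by blast
    show "x \<in> carrier E" "seminorm E r x \<le> 1" by fact+
    show "0 < 1 / (m1 + e)" using m e by simp
    show "L < norm (u' x) * (1 / (m1 + e) * c j k)"
    proof -
      have "0 < (m1 + e) * (m2 + e)" using e m by simp
      then have "L < norm (u x) * c j k / ((m1 + e) * (m2 + e))"
        using e by (simp only: pos_less_divide_eq)
      also have "\<dots> = norm (u' x) * (1 / (m1 + e) * c j k)" by (simp add: norm_u' mult_ac)
      finally show ?thesis .
    qed
    show "1 / (m1 + e) * c j q \<le> b i (\<phi> q)" if q: "q \<le> N" for q
    proof -
      have le: "ennreal (c j q) / ennreal (b i (\<phi> q)) \<le> ennreal m1"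
        using q unfolding m(1)[symmetric] M1_def by (intro Max_ge) auto
      show ?thesis
      proof (cases "b i (\<phi> q) = 0")
        case True
        then have "c j q = 0"
          \<comment> \<open>A positive numerator over 0 would be infinite, contrary to the finite
            maximum.\<close>
          using le cnn[of j q] by (cases "c j q = 0") (auto simp: ennreal_divide_zero top_unique)
        then show ?thesis using True by simp
      next
        case False
        then have pos: "0 < b i (\<phi> q)" using bnn[of i "\<phi> q"] by simp
        then have "c j q / b i (\<phi> q) \<le> m1" using le cnn m by (simp add: divide_ennreal)
        then have "c j q \<le> m1 * b i (\<phi> q)" using pos by (simp add: divide_le_eq)
        also have "\<dots> \<le> (m1 + e) * b i (\<phi> q)" using pos e by simp
        finally show ?thesis using m e by (simp add: divide_le_eq mult.commute)
      qed
    qed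
    show "b i q * norm (u' z) \<le> seminorm E (\<phi> q) z" if q: "q \<le> N" and z: "z \<in> carrier E" for q z
    proof -
      have le: "ennreal (b i q) * dual_norm E (\<phi> q) u \<le> ennreal m2"
        using q unfolding m(3)[symmetric] M2_def by (intro Max_ge) auto
      have unit: "b i q * norm (u y) \<le> m2" if "y \<in> carrier E" "seminorm E (\<phi> q) y \<le> 1" for y
      proof -
        have "ennreal (b i q) * ennreal (norm (u y)) \<le> ennreal (b i q) * dual_norm E (\<phi> q) u"
          unfolding dual_norm_def using that by (intro mult_left_mono SUP_upper) auto
        then have "ennreal (b i q * norm (u y)) \<le> ennreal m2"
          using le bnn by (simp add: ennreal_mult)
        then show ?thesis using m by simp
      qed
      have "b i q * norm (u z) \<le> (m2 + e) * seminorm E (\<phi> q) z"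
      proof (rule field_le_epsilon)
        fix d :: real assume d: "0 < d"
        \<comment> \<open>Normalisation by a number slightly above the seminorm of \<open>z\<close>,
          which may be 0.\<close>
        define w where "w = seminorm E (\<phi> q) z + d / (m2 + e)"
        have w: "0 < w" using d m e E.seminorm_nonneg[OF z, of "\<phi> q"] by (simp add: w_def add_nonneg_pos)
        have "seminorm E (\<phi> q) (scale E (of_real (1 / w)) z) \<le> 1"
          unfolding E.seminorm_scale[OF z] norm_of_real using w d m e by (simp add: divide_le_eq) (simp add: w_def)
        then have "b i q * norm (u (scale E (of_real (1 / w)) z)) \<le> m2"
          by (intro unit E.scale_mem[OF z])
        also have "u (scale E (of_real (1 / w)) z) = of_real (1 / w) * u z"
          using \<rho>(1) z unfolding linear_between_def by blast
        finally have "b i q * norm (u z) \<le> m2 * w"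
          unfolding norm_mult norm_of_real using w by (simp add: divide_le_eq)
        also have "\<dots> \<le> (m2 + e) * w" using w e by simp
        also have "\<dots> = (m2 + e) * seminorm E (\<phi> q) z + d" using m e by (simp add: w_def distrib_left)
        finally show "b i q * norm (u z) \<le> (m2 + e) * seminorm E (\<phi> q) z + d" .
      qed
      then show ?thesis using m e by (simp add: norm_u' divide_le_eq mult.commute)
    qed
  qed
qed

text \<open>By continuity the infimum runs over a nonempty set of indices and is attained.
  Monotonicity of the seminorms carries the bound on to \<open>r\<close>.\<close>

lemma continuity_index_leD:
  assumes E: "graded E" and F: "graded F" and T: "T \<in> continuous_operators E F"
    and le: "continuity_index E F T k \<le> r"
  shows "\<exists>B. \<forall>x\<in>carrier E. seminorm E r x \<le> 1 \<longrightarrow> seminorm F k (T x) \<le> B"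
proof -
  interpret E: graded E by fact
  interpret F: graded F by fact
  have maps: "T \<in> carrier E \<rightarrow> carrier F"
    using T unfolding continuous_operators_iff_bounded[OF E F] by blast
  obtain r' C where C: "0 \<le> C" "\<And>x. x \<in> carrier E \<Longrightarrow> seminorm F k (T x) \<le> C * seminorm E r' x"
    using T unfolding continuous_operators_iff_bounded[OF E F] by blast
  have "operator_norm E F k r' T \<le> ennreal C"
    unfolding operator_norm_def
  proof (intro SUP_least ennreal_leI)
    fix x assume "x \<in> {x \<in> carrier E. seminorm E r' x \<le> 1}"
    then show "seminorm F k (T x) \<le> C"
      using C(2)[of x] mult_left_mono[of "seminorm E r' x" 1 C] C(1) by simp
  qed
  then have "r' \<in> {r. operator_norm E F k r T < \<infinity>}"
    by (auto intro: le_less_trans)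
  then have "continuity_index E F T k \<in> {r. operator_norm E F k r T < \<infinity>}"
    unfolding continuity_index_def by (intro Inf_nat_def1) blast
  then have fin: "operator_norm E F k (continuity_index E F T k) T < \<infinity>" by simp
  have "seminorm F k (T x) \<le> enn2real (operator_norm E F k (continuity_index E F T k) T)"
    if x: "x \<in> carrier E" "seminorm E r x \<le> 1" for x
  proof -
    have "seminorm E (continuity_index E F T k) x \<le> 1"
      using E.seminorm_mono[OF le x(1)] x(2) by simp
    then have "ennreal (seminorm F k (T x)) \<le> operator_norm E F k (continuity_index E F T k) T"
      unfolding operator_norm_def using x by (intro SUP_upper) auto
    then have "enn2real (ennreal (seminorm F k (T x))) \<le> enn2real (operator_norm E F k (continuity_index E F T k) T)"
      using fin by (intro enn2real_mono) auto
    then show ?thesis using F.seminorm_nonneg maps x by (subst (asm) enn2real_ennreal) auto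
  qed
  then show ?thesis by blast
qed

lemma continuous_operators_compose:
  assumes E: "graded E" and G: "graded G" and F: "graded F"
    and Q: "Q \<in> continuous_operators E G" and R: "R \<in> continuous_operators G F"
  shows "(\<lambda>x. R (Q x)) \<in> continuous_operators E F"
proof -
  have "linear_between (carrier E) (scale E) (scale F) (\<lambda>x. R (Q x))"
    using Q R unfolding continuous_operators_def linear_between_def by (auto simp: Pi_iff)
  then show ?thesis
    using Q R continuous_map_compose[of "graded_topology E" "graded_topology G" Q "graded_topology F" R]
    unfolding continuous_operators_def by (auto simp: o_def)
qed

section \<open>Construction of an operator violating tameness\<close>

context koethe_target
begin

text \<open>The function \<open>S\<close> is the one from tameness. If the estimate failed for
  infinitely many \<open>k\<close>, one composition built from all counterexamples would be
  unbounded at each of these \<open>k\<close>.\<close>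

lemma max_estimate_if_tame_factorization:
  fixes E :: "('k, 'e::ab_group_add) graded_space"
  assumes E: "graded E" and b: "koethe_matrix b"
    and tame: "tame_factorization E (koethe_c0 b) F"
  shows "\<exists>S. mono S \<and> (\<forall>\<phi>. mono \<phi> \<longrightarrow>
    (\<exists>k0. \<forall>k\<ge>k0. \<exists>N C. C > 0 \<and> max_estimate E b c \<phi> (S k) k N C))"
proof -
  interpret E: graded E by fact
  interpret F: graded F by (rule graded)
  interpret c0: koethe_target "koethe_c0 b :: ('k, nat \<Rightarrow> 'k) graded_space" b "range (\<lambda>j. {j})"
    by (rule koethe_target_c0[OF b])
  interpret c0g: graded "koethe_c0 b :: ('k, nat \<Rightarrow> 'k) graded_space" by (rule c0.graded)
  note cnn = koethe_matrix_nonneg[OF koethe] and bnn = koethe_matrix_nonneg[OF b]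
  obtain S where S: "mono S"
    "\<And>T. T \<in> factorized_operators E (koethe_c0 b) F \<Longrightarrow> \<exists>k0. \<forall>k\<ge>k0. continuity_index E F T k \<le> S k"
    using tame unfolding tame_factorization_def by blast
  have "\<exists>k0. \<forall>k\<ge>k0. \<exists>N C. C > 0 \<and> max_estimate E b c \<phi> (S k) k N C" if "mono \<phi>" for \<phi>
  proof (rule ccontr)
    assume contra: "\<not> ?thesis"
    define A where "A = {k. \<forall>N C. C > 0 \<longrightarrow> \<not> max_estimate E b c \<phi> (S k) k N C}"
    have "\<exists>k\<ge>k0. k \<in> A" for k0 using contra unfolding A_def by blast
    then have A: "infinite A" unfolding infinite_nat_iff_unbounded_le by blast
    \<comment> \<open>The pairing makes every element of \<open>A\<close> occur as
      \<open>\<kappa> m\<close> for arbitrarily large \<open>m\<close>.\<close>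
    define \<kappa> where "\<kappa> m = enumerate A (fst (prod_decode m))" for m
    have \<kappa>: "\<kappa> m \<in> A" for m unfolding \<kappa>_def by (rule enumerate_in_set[OF A])
    \<comment> \<open>The \<open>m\<close>-th counterexample uses the columns up to \<open>m\<close>
      and the constant \<open>4 ^ m * (m + 1)\<close>: the power compensates the weights
      \<open>2^(-m)\<close> of both operators, and \<open>m + 1\<close> is left over.\<close>
    define P where "P m u i j x t \<longleftrightarrow> u \<in> topological_dual E \<and> x \<in> carrier E \<and>
        seminorm E (S (\<kappa> m)) x \<le> 1 \<and> 0 < t \<and>
        (\<forall>q\<le>m. \<forall>z\<in>carrier E. b i q * norm (u z) \<le> seminorm E (\<phi> q) z) \<and>
        (\<forall>q\<le>m. t * c j q \<le> b i (\<phi> q)) \<and>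
        4 ^ m * (real m + 1) < norm (u x) * (t * c j (\<kappa> m))" for m u i j x t
    have "\<exists>u i j x t. P m u i j x t" for m
    proof -
      have "\<not> max_estimate E b c \<phi> (S (\<kappa> m)) (\<kappa> m) m (4 ^ m * (real m + 1))"
        using \<kappa>[of m] by (simp add: A_def)
      from not_max_estimateE[OF E b koethe this] show ?thesis
        unfolding P_def by (metis add_pos_nonneg mult_pos_pos of_nat_0_le_iff zero_less_numeral zero_less_one zero_less_power add.commute)
    qed
    then obtain U I J X t where P: "\<And>m. P m (U m) (I m) (J m) (X m) (t m)" by metis
    have U: "U m \<in> topological_dual E" and X: "X m \<in> carrier E" "seminorm E (S (\<kappa> m)) (X m) \<le> 1"
      and t: "0 < t m" for m
      using P[of m] unfolding P_def by auto
    have Uq: "b (I m) q * norm (U m z) \<le> seminorm E (\<phi> q) z" if "q \<le> m" "z \<in> carrier E" for m q z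
      using P[of m] that unfolding P_def by blast
    have tq: "t m * c (J m) q \<le> b (I m) (\<phi> q)" if "q \<le> m" for m q
      using P[of m] that unfolding P_def by blast
    have big: "4 ^ m * (real m + 1) < norm (U m (X m)) * (t m * c (J m) (\<kappa> m))" for m
      using P[of m] unfolding P_def by blast
    have U_bound: "\<exists>r C. 0 \<le> C \<and> (\<forall>l. \<forall>z\<in>carrier E. b (I l) q * norm (U l z) \<le> C * seminorm E r z)" for q
    proof (rule uniform_bound_of_eventual[where \<rho> = "\<phi> q" and q = q])
      fix l
      obtain r C where "0 \<le> C" "\<And>x. x \<in> carrier E \<Longrightarrow> norm (U l x) \<le> C * seminorm E r x"
        using U[of l] unfolding topological_dual_iff_bounded[OF E] by blast
      then have "0 \<le> b (I l) q * C" "\<forall>z\<in>carrier E. b (I l) q * norm (U l z) \<le> b (I l) q * C * seminorm E r z"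
        using bnn by (auto simp: mult.assoc intro!: mult_left_mono)
      then show "\<exists>r C. 0 \<le> C \<and> (\<forall>z\<in>carrier E. b (I l) q * norm (U l z) \<le> C * seminorm E r z)" by blast
    qed (use Uq E.seminorm_mono E.seminorm_nonneg in auto)
    have t_bound: "\<exists>r C. 0 \<le> C \<and> (\<forall>l. t l * c (J l) q \<le> C * b (I l) r)" for q
    proof -
      \<comment> \<open>Here no vector is involved, so the uniform bound is taken over a one-point
        set.\<close>
      have "\<exists>r C. 0 \<le> C \<and> (\<forall>l. \<forall>z\<in>UNIV::unit set. t l * c (J l) q \<le> C * b (I l) r)"
      proof (rule uniform_bound_of_eventual[where \<rho> = "\<phi> q" and q = q])
        fix l
        obtain r where r: "0 < b (I l) r" using koethe_matrix_pos[OF b] by blast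
        then show "\<exists>r C. 0 \<le> C \<and> (\<forall>z\<in>UNIV::unit set. t l * c (J l) q \<le> C * b (I l) r)"
          using t[of l] cnn[of "J l" q]
          by (intro exI[of _ r] exI[of _ "t l * c (J l) q / b (I l) r"]) auto
      qed (use tq koethe_matrix_mono[OF b] bnn in auto)
      then show ?thesis by simp
    qed
    \<comment> \<open>\<open>R\<close> has positive coefficients. The signs are put into
      \<open>Q\<close> alone, so that they enter the composition linearly.\<close>
    define R where "R y j = (\<Sum>l. if J l = j then (1 / 2) ^ l * (of_real (t l) * y (I l)) else (0::'k))"
      for y :: "nat \<Rightarrow> 'k" and j
    have R_bound: "\<exists>r C. 0 \<le> C \<and> (\<forall>l. \<forall>y\<in>carrier (koethe_c0 b :: ('k, nat \<Rightarrow> 'k) graded_space).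
        c (J l) q * norm (of_real (t l) * y (I l)) \<le> C * seminorm (koethe_c0 b) r y)" for q
    proof -
      obtain r C where C: "0 \<le> C" "\<And>l. t l * c (J l) q \<le> C * b (I l) r" using t_bound[of q] by blast
      have "c (J l) q * norm (of_real (t l) * y (I l)) \<le> C * seminorm (koethe_c0 b) r y"
        if y: "y \<in> carrier (koethe_c0 b)" for l and y :: "nat \<Rightarrow> 'k"
      proof -
        have "c (J l) q * norm (of_real (t l) * y (I l)) = (t l * c (J l) q) * norm (y (I l))"
          using t[of l] by (simp add: norm_mult)
        also have "\<dots> \<le> (C * b (I l) r) * norm (y (I l))" by (intro mult_right_mono C) simp
        also have "\<dots> = C * (norm (y (I l)) * b (I l) r)" by simp
        also have "\<dots> \<le> C * seminorm (koethe_c0 b) r y"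
          by (intro mult_left_mono C c0.coordinate_le_seminorm y)
        finally show ?thesis .
      qed
      then show ?thesis using C(1) by blast
    qed
    have R: "R \<in> continuous_operators (koethe_c0 b) F"
    proof -
      have "linear_between (carrier (koethe_c0 b)) (scale (koethe_c0 b)) (*) (\<lambda>y. of_real (t l) * y (I l) :: 'k)" for l
        by (simp add: linear_between_def koethe_c0_simps(2) distrib_left mult.left_commute)
      from series_operator_continuous[OF c0.graded koethe this R_bound]
      show ?thesis using continuous_operators_l1_subset[OF c0.graded] unfolding R_def by blast
    qed
    \<comment> \<open>The joint contribution, without sign, of the \<open>l'\<close>-th term of
      \<open>R\<close> and the \<open>l\<close>-th term of \<open>Q\<close> to coordinate
      \<open>J m\<close> of the image of \<open>X m\<close>, weighted for the seminorm
      \<open>\<kappa> m\<close>.\<close>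
    define h where "h m l' l = of_real (c (J m) (\<kappa> m)) *
      (if J l' = J m \<and> I l' = I l then (1 / 2) ^ l' * (of_real (t l') * ((1 / 2) ^ l * U l (X m))) else 0)"
      for m l' l
    have half: "summable (\<lambda>l. (1 / 2) ^ l :: real)" by (simp add: summable_geometric)
    have h_bound: "\<exists>B\<ge>0. \<forall>l' l. norm (h m l' l) \<le> (1 / 2) ^ l' * ((1 / 2) ^ l * B)" for m
    proof -
      obtain r C where C: "0 \<le> C" "\<And>l. t l * c (J l) (\<kappa> m) \<le> C * b (I l) r" using t_bound by blast
      obtain r' C' where C': "0 \<le> C'" "\<And>l z. z \<in> carrier E \<Longrightarrow> b (I l) r * norm (U l z) \<le> C' * seminorm E r' z"
        using U_bound[of r] by blast
      define B where "B = C * (C' * seminorm E r' (X m))"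
      have B: "0 \<le> B" using C(1) C'(1) E.seminorm_nonneg[OF X(1)] by (simp add: B_def)
      have "norm (h m l' l) \<le> (1 / 2) ^ l' * ((1 / 2) ^ l * B)" for l' l
      proof (cases "J l' = J m \<and> I l' = I l")
        case True
        have "norm (h m l' l) = (1 / 2) ^ l' * ((1 / 2) ^ l * (t l' * c (J l') (\<kappa> m) * norm (U l (X m))))"
          using True t[of l'] cnn by (simp add: h_def norm_mult norm_power norm_divide)
        also have "t l' * c (J l') (\<kappa> m) * norm (U l (X m)) \<le> C * b (I l') r * norm (U l (X m))"
          by (intro mult_right_mono C) simp
        also have "\<dots> = C * (b (I l) r * norm (U l (X m)))" using True by simp
        also have "\<dots> \<le> B" unfolding B_def by (intro mult_left_mono C C' X)
        finally show ?thesis by simp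
      qed (use B in \<open>auto simp: h_def\<close>)
      then show ?thesis using B by blast
    qed
    define g where "g m l = (\<Sum>l'. h m l' l)" for m l
    have h_summable: "summable (\<lambda>l'. norm (h m l' l))" for m l
    proof -
      obtain B where "\<And>l'. norm (h m l' l) \<le> (1 / 2) ^ l' * ((1 / 2) ^ l * B)" using h_bound by blast
      then show ?thesis by (intro summable_comparison_test'[OF summable_half, of 0]) auto
    qed
    have g_summable: "summable (\<lambda>l. norm (g m l))" for m
    proof -
      obtain B where B: "\<And>l' l. norm (h m l' l) \<le> (1 / 2) ^ l' * ((1 / 2) ^ l * B)" using h_bound by blast
      have "norm (g m l) \<le> (1 / 2) ^ l * (B * (\<Sum>l'. (1 / 2) ^ l'))" for l
      proof -
        have "norm (g m l) \<le> (\<Sum>l'. norm (h m l' l))" unfolding g_def by (rule summable_norm[OF h_summable])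
        also have "\<dots> \<le> (\<Sum>l'. (1 / 2) ^ l' * ((1 / 2) ^ l * B))"
          by (rule suminf_le[OF B h_summable summable_half])
        also have "\<dots> = (\<Sum>l'. (1 / 2) ^ l') * ((1 / 2) ^ l * B)" by (rule suminf_mult2[OF half, symmetric])
        finally show ?thesis by (simp add: mult_ac)
      qed
      then show ?thesis by (intro summable_comparison_test'[OF summable_half, of 0]) auto
    qed
    \<comment> \<open>All summands of \<open>g m m\<close> are nonnegative multiples of the same
      number \<open>U m (X m)\<close>. Nothing cancels, and the summand \<open>l' = m\<close> is a
      lower bound.\<close>
    have g_diag: "real m < norm (g m m)" for m
    proof -
      define f where "f l' = c (J m) (\<kappa> m) * (if J l' = J m \<and> I l' = I m then (1 / 2) ^ l' * t l' else 0)" for l'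
      have f0: "0 \<le> f l'" for l' using cnn t[of l'] by (simp add: f_def)
      obtain r C where C: "0 \<le> C" "\<And>l. t l * c (J l) (\<kappa> m) \<le> C * b (I l) r" using t_bound by blast
      have "f l' \<le> (1 / 2) ^ l' * (C * b (I m) r)" for l'
      proof (cases "J l' = J m \<and> I l' = I m")
        case True
        then have "f l' = (1 / 2) ^ l' * (t l' * c (J l') (\<kappa> m))" by (simp add: f_def)
        also have "\<dots> \<le> (1 / 2) ^ l' * (C * b (I l') r)" by (intro mult_left_mono C) simp
        finally show ?thesis using True by simp
      qed (use C(1) bnn in \<open>auto simp: f_def\<close>)
      then have f: "summable f"
        using f0 by (intro summable_comparison_test'[OF summable_half, of 0]) auto
      have "h m l' m = of_real (f l') * ((1 / 2) ^ m * U m (X m))" for l'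
        by (simp add: h_def f_def)
      then have "g m m = (\<Sum>l'. of_real (f l')) * ((1 / 2) ^ m * U m (X m))"
        unfolding g_def by (simp only: suminf_mult2[OF summable_of_real[OF f]])
      also have "\<dots> = of_real (suminf f) * ((1 / 2) ^ m * U m (X m))"
        by (simp only: suminf_of_real[OF f])
      finally have "norm (g m m) = suminf f * ((1 / 2) ^ m * norm (U m (X m)))"
        using suminf_nonneg[OF f f0] by (simp add: norm_mult norm_power norm_divide)
      moreover have "f m \<le> suminf f"
        using sum_le_suminf[OF f, of "{m}"] f0 by simp
      ultimately have "f m * ((1 / 2) ^ m * norm (U m (X m))) \<le> norm (g m m)"
        by (simp add: mult_right_mono)
      moreover have "f m * ((1 / 2) ^ m * norm (U m (X m))) = (1 / 4) ^ m * (norm (U m (X m)) * (t m * c (J m) (\<kappa> m)))"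
        by (simp add: f_def power_mult_distrib[symmetric])
      moreover have "(1 / 4) ^ m * (4 ^ m * (real m + 1)) < (1 / 4) ^ m * (norm (U m (X m)) * (t m * c (J m) (\<kappa> m)))"
        using big[of m] by (intro mult_strict_left_mono) auto
      moreover have "(1 / 4) ^ m * (4 ^ m * (real m + 1)) = real m + 1"
        by (simp add: power_one_over)
      ultimately show ?thesis by linarith
    qed
    have unbounded: "\<exists>m\<in>{m. \<kappa> m = k}. B < norm (g m m)" if kA: "k \<in> A" for k B
    proof -
      obtain n where n: "enumerate A n = k" using enumerate_Ex[OF A kA] by blast
      \<comment> \<open>The first component selects \<open>k\<close>, the second makes
        \<open>m\<close> at least \<open>B\<close>.\<close>
      define m where "m = prod_encode (n, nat \<lceil>B\<rceil>)"
      have "B \<le> real (nat \<lceil>B\<rceil>)" by linarith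
      also have "\<dots> \<le> real m" using le_prod_encode_2[of "nat \<lceil>B\<rceil>" n] by (simp add: m_def)
      also have "\<dots> < norm (g m m)" by (rule g_diag)
      finally show ?thesis by (intro bexI[of _ m]) (auto simp: \<kappa>_def m_def n)
    qed
    \<comment> \<open>The signs are chosen only after \<open>R\<close> and \<open>g\<close>, neither
      of which involves them.\<close>
    have "\<exists>a::nat \<Rightarrow> real. (\<forall>l. a l \<in> {-1, 1}) \<and>
        (\<forall>k\<in>A. \<forall>B. \<exists>m\<in>{m. \<kappa> m = k}. B < norm (\<Sum>l. of_real (a l) * g m l))"
      by (rule unbounded_sign_series[OF g_summable countableI_type unbounded])
    then obtain a :: "nat \<Rightarrow> real" where a: "\<forall>l. a l \<in> {-1, 1}"
      and blowup: "\<forall>k\<in>A. \<forall>B. \<exists>m\<in>{m. \<kappa> m = k}. B < norm (\<Sum>l. of_real (a l) * g m l)"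
      by (elim exE conjE)
    have abs_a: "\<bar>a l\<bar> = 1" for l
    proof -
      have "a l = -1 \<or> a l = 1" using a by simp
      then show ?thesis by auto
    qed
    define Q where "Q z i = (\<Sum>l. if I l = i then (1 / 2) ^ l * (of_real (a l) * U l z) else 0)" for z i
    have Q_bound: "\<exists>r C. 0 \<le> C \<and> (\<forall>l. \<forall>z\<in>carrier E. b (I l) q * norm (of_real (a l) * U l z) \<le> C * seminorm E r z)" for q
      using U_bound[of q] by (simp add: norm_mult abs_a)
    have Q: "Q \<in> continuous_operators E (koethe_c0 b)"
    proof -
      have "linear_between (carrier E) (scale E) (*) (\<lambda>z. of_real (a l) * U l z)" for l
        using U[of l] unfolding topological_dual_iff_bounded[OF E]
        by (simp add: linear_between_def distrib_left mult.left_commute)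
      from series_operator_continuous[OF E b this Q_bound]
      show ?thesis using c0.continuous_operators_l1_subset[OF E] unfolding Q_def by blast
    qed
    have T: "(\<lambda>x. R (Q x)) \<in> continuous_operators E F"
      by (rule continuous_operators_compose[OF E c0.graded graded Q R])
    then have "(\<lambda>x. R (Q x)) \<in> factorized_operators E (koethe_c0 b) F"
      unfolding factorized_operators_def using Q R by blast
    then obtain k0 where k0: "\<And>k. k \<ge> k0 \<Longrightarrow> continuity_index E F (\<lambda>x. R (Q x)) k \<le> S k"
      using S(2) by blast
    obtain k where k: "k \<ge> k0" "k \<in> A" using A unfolding infinite_nat_iff_unbounded_le by blast
    obtain B where B: "\<And>x. x \<in> carrier E \<Longrightarrow> seminorm E (S k) x \<le> 1 \<Longrightarrow> seminorm F k (R (Q x)) \<le> B"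
      using continuity_index_leD[OF E graded T k0[OF k(1)]] by blast
    obtain m where m: "\<kappa> m = k" "B < norm (\<Sum>l. of_real (a l) * g m l)" using blowup k(2) by blast
    \<comment> \<open>The coordinate is a double series over the terms of \<open>R\<close> and
      \<open>Q\<close>. Exchanging the sums gathers, for each term of \<open>Q\<close>, everything
      that carries its sign.\<close>
    have "of_real (c (J m) (\<kappa> m)) * R (Q (X m)) (J m) = (\<Sum>l. of_real (a l) * g m l)"
    proof -
      let ?c = "of_real (c (J m) (\<kappa> m)) :: 'k"
      obtain B' where B': "0 \<le> B'" "\<And>l' l. norm (h m l' l) \<le> (1 / 2) ^ l' * ((1 / 2) ^ l * B')"
        using h_bound by blast
      have Qmem: "Q (X m) \<in> carrier (koethe_c0 b)" using Q X unfolding continuous_operators_def by blast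
      have "?c * R (Q (X m)) (J m) =
          (\<Sum>l'. ?c * (if J l' = J m then (1 / 2) ^ l' * (of_real (t l') * Q (X m) (I l')) else 0))"
        unfolding R_def
        by (rule suminf_mult[symmetric])
          (rule summable_norm_cancel[OF series_operator_summable[OF koethe Qmem R_bound]])
      also have "\<dots> = (\<Sum>l'. \<Sum>l. of_real (a l) * h m l' l)"
      proof (rule suminf_cong)
        fix l'
        let ?q = "\<lambda>l. if I l = I l' then (1 / 2) ^ l * (of_real (a l) * U l (X m)) else 0"
        have q: "summable ?q"
          by (rule summable_norm_cancel[OF series_operator_summable[OF b X(1) Q_bound]])
        have "of_real (a l) * h m l' l = ?c * (if J l' = J m then (1 / 2) ^ l' * of_real (t l') else 0) * ?q l" for l
          by (auto simp: h_def)
        then have "(\<Sum>l. of_real (a l) * h m l' l) = ?c * (if J l' = J m then (1 / 2) ^ l' * of_real (t l') else 0) * Q (X m) (I l')"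
          unfolding Q_def by (simp only: suminf_mult[OF q])
        then show "?c * (if J l' = J m then (1 / 2) ^ l' * (of_real (t l') * Q (X m) (I l')) else 0) =
            (\<Sum>l. of_real (a l) * h m l' l)"
          by (simp add: mult.assoc)
      qed
      also have "\<dots> = (\<Sum>l. \<Sum>l'. of_real (a l) * h m l' l)"
      proof (rule suminf_swap[where a = "\<lambda>l'. (1 / 2) ^ l'" and b = "\<lambda>l. (1 / 2) ^ l * B'"])
        show "norm (of_real (a l) * h m l' l) \<le> (1 / 2) ^ l' * ((1 / 2) ^ l * B')" for l' l
          using B'(2)[of l' l] by (simp add: norm_mult abs_a)
      qed (use half summable_half B'(1) in auto)
      also have "\<dots> = (\<Sum>l. of_real (a l) * g m l)"
        unfolding g_def by (intro suminf_cong suminf_mult summable_norm_cancel[OF h_summable])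
      finally show ?thesis .
    qed
    then have "norm (\<Sum>l. of_real (a l) * g m l) = norm (R (Q (X m)) (J m)) * c (J m) k"
      using cnn m(1) by (metis abs_of_nonneg mult.commute norm_mult norm_of_real)
    also have "\<dots> \<le> seminorm F k (R (Q (X m)))"
      using T X by (intro coordinate_le_seminorm) (auto simp: continuous_operators_def)
    also have "\<dots> \<le> B" using X(2)[of m] m(1) by (intro B X) simp
    finally show False using m(2) by simp
  qed
  then show ?thesis using S(1) by blast
qed

end

section \<open>The equivalence for both targets\<close>

theorem proposition4p4:
  fixes E :: "('k::real_or_complex, 'e::ab_group_add) graded_space"
    and b c :: "nat \<Rightarrow> nat \<Rightarrow> real"
  assumes "frechet_space E" and "koethe_matrix b" and "koethe_matrix c"
  shows "(tame_factorization E (koethe_c0 b) (koethe_l1 c) \<longleftrightarrow>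
          tame_factorization E (koethe_c0 b) (koethe_linf c)) \<and>
         (tame_factorization E (koethe_c0 b) (koethe_linf c) \<longleftrightarrow>
          (\<exists>S::nat \<Rightarrow> nat. mono S \<and>
            (\<forall>\<phi>::nat \<Rightarrow> nat. mono \<phi> \<longrightarrow>
              (\<exists>k0. \<forall>k\<ge>k0. \<exists>qk::nat. \<exists>Ck::real. Ck > 0 \<and>
                (\<forall>u\<in>topological_dual E. \<forall>i j.
                  dual_norm E (S k) u * ennreal (c j k) \<le>
                  ennreal Ck *
                  max_product
                    (MAX q\<in>{..qk}. ennreal (c j q) / ennreal (b i (\<phi> q)))
                    (MAX q\<in>{..qk}. ennreal (b i q) * dual_norm E (\<phi> q) u))))))"
proof -
  note E = frechet_space_graded[OF assms(1)]
  interpret l1: koethe_target "koethe_l1 c :: ('k, nat \<Rightarrow> 'k) graded_space" c "Collect finite"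
    by (rule koethe_target_l1[OF assms(3)])
  interpret linf: koethe_target "koethe_linf c :: ('k, nat \<Rightarrow> 'k) graded_space" c "range (\<lambda>j. {j})"
    by (rule koethe_target_linf[OF assms(3)])
  \<comment> \<open>The condition refers to the matrix \<open>c\<close> but not to the choice
    between the two targets, so it links the two tameness statements.\<close>
  let ?cond = "\<exists>S. mono S \<and> (\<forall>\<phi>. mono \<phi> \<longrightarrow>
    (\<exists>k0. \<forall>k\<ge>k0. \<exists>N C. C > 0 \<and> max_estimate E b c \<phi> (S k) k N C))"
  have "tame_factorization E (koethe_c0 b) (koethe_l1 c) \<longleftrightarrow> ?cond"
    using l1.max_estimate_if_tame_factorization[OF E assms(2)]
      l1.tame_factorization_if_max_estimate[OF E assms(2)] by (intro iffI) (assumption | elim exE conjE | blast)+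
  moreover have "tame_factorization E (koethe_c0 b) (koethe_linf c) \<longleftrightarrow> ?cond"
    using linf.max_estimate_if_tame_factorization[OF E assms(2)]
      linf.tame_factorization_if_max_estimate[OF E assms(2)] by (intro iffI) (assumption | elim exE conjE | blast)+
  ultimately show ?thesis unfolding max_estimate_def by (intro conjI) (simp_all only:)
qed

end
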